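(* Let $0<\alpha<1$ and let $f\in C^{2,\alpha}(S^1)$ be a positive even function with $\|f\|_{L^1}<\frac{1}{\sqrt{2\pi}}$. Then there exists a $C^{4,\alpha}$, origin-symmetric convex body $K\subset\mathbb{R}^2$ with $\gamma_2(K)<\frac12$ such that its support function $h$ solves $$\frac{1}{2\pi}\, e^{-\frac{h'^2+h^2}{2}}\,(h''+h)=f \quad\text{on } S^1.$$
   Context: A convex body in $\mathbb{R}^2$ is a compact convex set with nonempty interior. Its support function $h(v)=\max\{x\cdot v:x\in K\}$, $v\in S^1$, is regarded as a $2\pi$-periodic function of the angle, and $'$ is the derivative with respect to the angle. A function $f$ on $S^1$ is even if $f(-v)=f(v)$; $K$ is origin-symmetric if $K=-K$. The Gaussian probability measure is $\gamma_2(E)=\frac{1}{2\pi}\int_E e^{-|x|^2/2}\,dx$. The norm $\|f\|_{L^1}$ is taken with respect to arc length (spherical Lebesgue measure) on $S^1$. *)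

theory Defs
  imports "HOL-Analysis.Analysis"
begin

text \<open>Differentiability is demanded explicitly below order \<open>k\<close>, because \<^const>\<open>deriv\<close> is total.
  The Hoelder bound is uniform on \<open>S\<close>, which is meant to be open.\<close>

definition C_holder_on :: "real set \<Rightarrow> nat \<Rightarrow> real \<Rightarrow> (real \<Rightarrow> real) \<Rightarrow> bool" where
  "C_holder_on S k \<alpha> g \<longleftrightarrow>
     (\<forall>j<k. \<forall>x\<in>S. (deriv ^^ j) g differentiable (at x)) \<and>
     continuous_on S ((deriv ^^ k) g) \<and>
     (\<exists>C. \<forall>x\<in>S. \<forall>y\<in>S. \<bar>(deriv ^^ k) g x - (deriv ^^ k) g y\<bar> \<le> C * \<bar>x - y\<bar> powr \<alpha>)"

definition circle_point :: "real \<Rightarrow> real ^ 2" where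
  "circle_point \<theta> = vector [cos \<theta>, sin \<theta>]"

text \<open>A function on \<open>S\<^sup>1\<close> is a function on the plane of which only the values on \<^term>\<open>sphere 0 1\<close>
  matter; it is turned into a \<open>2\<pi>\<close>-periodic function of the angle.  For a periodic function,
  a Hoelder bound on the whole line is the same as one with respect to distance on the circle.\<close>

definition of_angle :: "(real ^ 2 \<Rightarrow> real) \<Rightarrow> real \<Rightarrow> real" where
  "of_angle f = (\<lambda>\<theta>. f (circle_point \<theta>))"

definition C_holder_circle :: "nat \<Rightarrow> real \<Rightarrow> (real ^ 2 \<Rightarrow> real) \<Rightarrow> bool" where
  "C_holder_circle k \<alpha> f \<longleftrightarrow> C_holder_on UNIV k \<alpha> (of_angle f)"

definition L1_norm_circle :: "(real ^ 2 \<Rightarrow> real) \<Rightarrow> real" where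
  "L1_norm_circle f = (LINT \<theta>:{0..2 * pi}|lborel. \<bar>of_angle f \<theta>\<bar>)"

definition convex_body :: "(real ^ 2) set \<Rightarrow> bool" where
  "convex_body K \<longleftrightarrow> compact K \<and> convex K \<and> interior K \<noteq> {}"

definition origin_symmetric :: "(real ^ 2) set \<Rightarrow> bool" where
  "origin_symmetric K \<longleftrightarrow> K = uminus ` K"

text \<open>The supremum is a maximum for compact nonempty \<open>K\<close>.\<close>

definition support_function :: "(real ^ 2) set \<Rightarrow> real ^ 2 \<Rightarrow> real" where
  "support_function K v = (SUP x\<in>K. x \<bullet> v)"

text \<open>The boundary is a \<open>C\<^sup>k\<^sup>,\<^sup>\<alpha>\<close> curve: near each of its points \<open>p\<close> it is, in orthonormal
  coordinates \<open>(e, n)\<close> centred at \<open>p\<close>, the graph of a \<open>C\<^sup>k\<^sup>,\<^sup>\<alpha>\<close> function (intended for \<open>k \<ge> 1\<close>).\<close>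

definition C_holder_boundary :: "nat \<Rightarrow> real \<Rightarrow> (real ^ 2) set \<Rightarrow> bool" where
  "C_holder_boundary k \<alpha> K \<longleftrightarrow>
     (\<forall>p\<in>frontier K. \<exists>U e n r g.
        open U \<and> p \<in> U \<and> norm e = 1 \<and> norm n = 1 \<and> e \<bullet> n = 0 \<and> r > 0 \<and>
        C_holder_on {-r<..<r} k \<alpha> g \<and>
        frontier K \<inter> U = (\<lambda>s. p + s *\<^sub>R e + g s *\<^sub>R n) ` {-r<..<r})"

definition gaussian_plane :: "(real ^ 2) measure" where
  "gaussian_plane = density lborel (\<lambda>x. ennreal (exp (- (norm x)\<^sup>2 / 2) / (2 * pi)))"

end

theory Submission
  imports Defs
begin

text \<open>
The boundary point \<open>x(t)\<close> of a smooth convex body whose outer normal has angle \<open>t\<close>, as a complex number,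
has velocity \<open>i e\<^sup>i\<^sup>t (h'' + h)\<close>, and \<open>|x|\<^sup>2 = h\<^sup>2 + h'\<^sup>2\<close>.  The equation for the support function is therefore
the first-order system
\<open>x'(t) = i e\<^sup>i\<^sup>t F(t) exp (|x(t)|\<^sup>2 / 2)\<close>, \<open>F = 2 \<pi> f\<close>,
and origin symmetry is the boundary condition \<open>x(t + \<pi>) = - x(t)\<close>, which the system respects because
\<open>f\<close> is even.  The initial values \<open>x(0)\<close> form a plane, so that the two-dimensional fixed point theorem of
Brouwer suffices to find an antiperiodic solution, once there is an a priori bound.

The bound is \<open>|x| < 1\<close>.  Along a solution \<open>exp (- |x|\<^sup>2 / 2) |x'| = F\<close>, so over half a turn the curve
has Gaussian-weighted length \<open>\<integral> F = \<pi> \<parallel>f\<parallel>\<close>, and the hypothesis on the norm of \<open>f\<close> says exactly that this is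
less than \<open>sqrt (\<pi>/2)\<close>.  In half a turn the curve goes from \<open>x(t)\<close> to \<open>- x(t)\<close>.  If \<open>|x(t)| = 1\<close>, this takes
weighted length at least \<open>1.28 > sqrt (\<pi>/2)\<close>, as an explicit cubic polynomial shows whose gradient is dominated by
the weight (\<open>calibration_gradient\<close>, \<open>no_short_crossing\<close>).  With the weight frozen outside the unit
disc, the equation is globally Lipschitz (\<open>picard_flow\<close> solves it, with continuous dependence on the initial
value), and the same estimate holds for solutions that leave the disc; it excludes the artificial fixed
points that a retraction onto the disc might produce.  The outcome is \<open>closed_orbit\<close>.

From \<open>x\<close> the functions \<open>h\<close>, \<open>k = h'\<close> and \<open>g = h'' + h > 0\<close> are read off in the rotating frame.  Because \<open>g\<close> is
positive, \<open>h\<close> is the support function of \<open>{y. y \<bullet> u \<le> h(u) for all u}\<close>, whose boundary is the curve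
(\<open>support_function_body\<close>, \<open>frontier_body\<close>).  Since the body lies in a disc of radius \<open>R < 1\<close>, its Gaussian measure is at most
\<open>R\<^sup>2 / 2 < 1/2\<close>.  The equation gives \<open>h\<close> two more orders of regularity than \<open>f\<close> has, and the
boundary, written as a graph over a tangent line, has a second derivative that is as regular as the radius of
curvature \<open>g\<close> (\<open>support_regularity\<close>, \<open>body_boundary_holder\<close>).
\<close>

section \<open>Bounded functions with a Hoelder continuous derivative\<close>

text \<open>The derivatives are existentially quantified rather than iterated with \<^const>\<open>deriv\<close>, so that every
closure property below is an induction on the order in which one derivative is named explicitly.
Boundedness is what makes Hoelder functions of every order an algebra, and on the whole line it does not
follow from the Hoelder bound.\<close>

primrec bounded_holder :: "nat \<Rightarrow> real \<Rightarrow> real set \<Rightarrow> (real \<Rightarrow> real) \<Rightarrow> bool" where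
  "bounded_holder 0 \<alpha> S g \<longleftrightarrow>
     bounded (g ` S) \<and> (\<exists>C. \<forall>x\<in>S. \<forall>y\<in>S. \<bar>g x - g y\<bar> \<le> C * \<bar>x - y\<bar> powr \<alpha>)"
| "bounded_holder (Suc k) \<alpha> S g \<longleftrightarrow>
     bounded (g ` S) \<and>
     (\<exists>g'. (\<forall>x\<in>S. (g has_real_derivative g' x) (at x)) \<and> bounded_holder k \<alpha> S g')"

lemma bounded_holder_bounded: "bounded_holder k \<alpha> S g \<Longrightarrow> bounded (g ` S)"
  by (cases k) auto

lemma bounded_holder_SucI:
  assumes "bounded (g ` S)" "\<And>x. x \<in> S \<Longrightarrow> (g has_real_derivative g' x) (at x)"
    and "bounded_holder k \<alpha> S g'"
  shows "bounded_holder (Suc k) \<alpha> S g"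
  using assms by auto

lemma bounded_image_real: "bounded (g ` S) \<longleftrightarrow> (\<exists>B\<ge>0. \<forall>x\<in>S. \<bar>g x\<bar> \<le> B)" for g :: "'a \<Rightarrow> real"
proof -
  have "\<exists>B\<ge>0. \<forall>x\<in>S. \<bar>g x\<bar> \<le> B" if "\<forall>x\<in>S. \<bar>g x\<bar> \<le> B" for B
    using that by (intro exI[of _ "max 0 B"]) auto
  then show ?thesis unfolding bounded_iff by auto
qed

lemma bounded_holderD:
  assumes "bounded_holder k \<alpha> S g"
  obtains B where "B \<ge> 0" "\<And>x. x \<in> S \<Longrightarrow> \<bar>g x\<bar> \<le> B"
  using bounded_holder_bounded[OF assms] unfolding bounded_image_real by blast

text \<open>At distance at most \<open>1\<close> the Lipschitz bound is stronger than the Hoelder bound; at larger distances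
boundedness alone gives it.\<close>

lemma bounded_holder_0_if_lipschitz:
  assumes "0 \<le> \<alpha>" "\<alpha> \<le> 1" "bounded (g ` S)"
    and L: "\<And>x y. x \<in> S \<Longrightarrow> y \<in> S \<Longrightarrow> \<bar>g x - g y\<bar> \<le> L * \<bar>x - y\<bar>"
  shows "bounded_holder 0 \<alpha> S g"
proof -
  obtain B where B: "B \<ge> 0" "\<And>x. x \<in> S \<Longrightarrow> \<bar>g x\<bar> \<le> B"
    using assms(3) unfolding bounded_image_real by blast
  have "\<bar>g x - g y\<bar> \<le> (\<bar>L\<bar> + 2 * B) * \<bar>x - y\<bar> powr \<alpha>" if "x \<in> S" "y \<in> S" for x y
  proof (cases "\<bar>x - y\<bar> \<le> 1")
    case True
    have "\<bar>x - y\<bar> \<le> \<bar>x - y\<bar> powr \<alpha>"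
      using powr_mono'[of \<alpha> 1 "\<bar>x - y\<bar>"] True assms(1,2) by simp
    then have "\<bar>L\<bar> * \<bar>x - y\<bar> \<le> (\<bar>L\<bar> + 2 * B) * \<bar>x - y\<bar> powr \<alpha>"
      using B(1) by (intro mult_mono) auto
    moreover have "L * \<bar>x - y\<bar> \<le> \<bar>L\<bar> * \<bar>x - y\<bar>" by (intro mult_right_mono) auto
    ultimately show ?thesis using L[OF that] by linarith
  next
    case False
    then have "1 \<le> \<bar>x - y\<bar> powr \<alpha>" using assms(1) by (intro ge_one_powr_ge_zero) auto
    then have "(\<bar>L\<bar> + 2 * B) * 1 \<le> (\<bar>L\<bar> + 2 * B) * \<bar>x - y\<bar> powr \<alpha>"
      using B(1) by (intro mult_left_mono) auto
    moreover have "\<bar>g x - g y\<bar> \<le> 2 * B" using B(2)[OF that(1)] B(2)[OF that(2)] by linarith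
    then have "\<bar>g x - g y\<bar> \<le> (\<bar>L\<bar> + 2 * B) * 1" by (rule order_trans) simp
    ultimately show ?thesis by (rule order_trans[rotated])
  qed
  then show ?thesis using assms(3) by auto
qed

lemma lipschitz_if_derivative_bounded:
  assumes "convex S" and "\<And>x. x \<in> S \<Longrightarrow> (g has_real_derivative g' x) (at x)"
    and "\<And>x. x \<in> S \<Longrightarrow> \<bar>g' x\<bar> \<le> B" and "x \<in> S" "y \<in> S"
  shows "\<bar>g x - g y\<bar> \<le> B * \<bar>x - y\<bar>"
  using field_differentiable_bound[of S g g' B x y] assms
  by (auto intro: has_field_derivative_at_within)

lemma bounded_holder_Suc_imp:
  assumes "convex S" "0 \<le> \<alpha>" "\<alpha> \<le> 1" "bounded_holder (Suc k) \<alpha> S g"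
  shows "bounded_holder k \<alpha> S g"
  using assms(4)
proof (induction k arbitrary: g)
  case 0
  then obtain g' where D: "\<And>x. x \<in> S \<Longrightarrow> (g has_real_derivative g' x) (at x)"
    and "bounded (g ` S)" "bounded (g' ` S)" by auto
  moreover then obtain B where "\<And>x. x \<in> S \<Longrightarrow> \<bar>g' x\<bar> \<le> B"
    unfolding bounded_image_real by blast
  ultimately have "bounded (g ` S)" "\<bar>g x - g y\<bar> \<le> B * \<bar>x - y\<bar>" if "x \<in> S" "y \<in> S" for x y
    using lipschitz_if_derivative_bounded[OF assms(1) D] that by auto
  then show ?case
    using assms(2,3) \<open>bounded (g ` S)\<close> by (intro bounded_holder_0_if_lipschitz) auto
next
  case (Suc k)
  then show ?case by (metis bounded_holder.simps(2))
qed

lemma bounded_holder_mono: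
  assumes "convex S" "0 \<le> \<alpha>" "\<alpha> \<le> 1" "bounded_holder k \<alpha> S g" "j \<le> k"
  shows "bounded_holder j \<alpha> S g"
  using assms(5,4) by (induction rule: dec_induct) (use bounded_holder_Suc_imp assms(1-3) in blast)+

lemma bounded_holder_subset:
  assumes "bounded_holder k \<alpha> S g" "R \<subseteq> S"
  shows "bounded_holder k \<alpha> R g"
  using assms(1)
proof (induction k arbitrary: g)
  case 0
  then show ?case using assms(2) bounded_subset[OF _ image_mono[OF assms(2)]] by fastforce
next
  case (Suc k)
  then show ?case using assms(2) bounded_subset[OF _ image_mono[OF assms(2)]] by fastforce
qed

lemma bounded_holder_const: "bounded_holder k \<alpha> S (\<lambda>x. c)"
proof (induction k arbitrary: c)
  case 0
  show ?case by (auto simp: bounded_image_real intro!: exI[of _ 0] exI[of _ "\<bar>c\<bar>"])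
next
  case (Suc k)
  then show ?case
    by (auto simp: bounded_image_real intro!: exI[of _ "\<lambda>_. 0"] exI[of _ "\<bar>c\<bar>"])
qed

lemma bounded_holder_add:
  assumes "bounded_holder k \<alpha> S f" "bounded_holder k \<alpha> S g"
  shows "bounded_holder k \<alpha> S (\<lambda>x. f x + g x)"
  using assms
proof (induction k arbitrary: f g)
  case 0
  then obtain C D where C: "\<forall>x\<in>S. \<forall>y\<in>S. \<bar>f x - f y\<bar> \<le> C * \<bar>x - y\<bar> powr \<alpha>"
    and D: "\<forall>x\<in>S. \<forall>y\<in>S. \<bar>g x - g y\<bar> \<le> D * \<bar>x - y\<bar> powr \<alpha>" by auto
  have "\<bar>f x + g x - (f y + g y)\<bar> \<le> (C + D) * \<bar>x - y\<bar> powr \<alpha>" if "x \<in> S" "y \<in> S" for x y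
    using C[rule_format, OF that] D[rule_format, OF that] by (simp add: distrib_right)
  then show ?case using 0 by (auto intro: bounded_plus_comp)
next
  case (Suc k)
  then obtain f' g' where "\<forall>x\<in>S. (f has_real_derivative f' x) (at x)" "bounded_holder k \<alpha> S f'"
    "\<forall>x\<in>S. (g has_real_derivative g' x) (at x)" "bounded_holder k \<alpha> S g'" by auto
  then have "\<forall>x\<in>S. ((\<lambda>x. f x + g x) has_real_derivative (f' x + g' x)) (at x)"
    "bounded_holder k \<alpha> S (\<lambda>x. f' x + g' x)" using Suc.IH by (auto intro: DERIV_add)
  then show ?case using Suc.prems by (auto intro: bounded_plus_comp)
qed

lemma bounded_mult_image:
  fixes f g :: "real \<Rightarrow> real"
  assumes "bounded (f ` S)" "bounded (g ` S)" shows "bounded ((\<lambda>x. f x * g x) ` S)"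
proof -
  obtain A B where "A \<ge> 0" "\<And>x. x \<in> S \<Longrightarrow> \<bar>f x\<bar> \<le> A" "B \<ge> 0" "\<And>x. x \<in> S \<Longrightarrow> \<bar>g x\<bar> \<le> B"
    using assms unfolding bounded_image_real by blast
  then show ?thesis unfolding bounded_image_real
    by (intro exI[of _ "A * B"]) (auto simp: abs_mult intro!: mult_mono)
qed

lemma bounded_holder_mult:
  assumes S: "convex S" "0 \<le> \<alpha>" "\<alpha> \<le> 1"
    and "bounded_holder k \<alpha> S f" "bounded_holder k \<alpha> S g"
  shows "bounded_holder k \<alpha> S (\<lambda>x. f x * g x)"
  using assms(4,5)
proof (induction k arbitrary: f g)
  case 0
  then obtain C D where C: "\<forall>x\<in>S. \<forall>y\<in>S. \<bar>f x - f y\<bar> \<le> C * \<bar>x - y\<bar> powr \<alpha>"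
    and D: "\<forall>x\<in>S. \<forall>y\<in>S. \<bar>g x - g y\<bar> \<le> D * \<bar>x - y\<bar> powr \<alpha>" by auto
  obtain A where A: "A \<ge> 0" "\<And>x. x \<in> S \<Longrightarrow> \<bar>f x\<bar> \<le> A" by (rule bounded_holderD[OF 0(1)]) blast
  obtain B where B: "B \<ge> 0" "\<And>x. x \<in> S \<Longrightarrow> \<bar>g x\<bar> \<le> B" by (rule bounded_holderD[OF 0(2)]) blast
  have "\<bar>f x * g x - f y * g y\<bar> \<le> (A * D + B * C) * \<bar>x - y\<bar> powr \<alpha>" if xy: "x \<in> S" "y \<in> S" for x y
  proof -
    have "f x * g x - f y * g y = f x * (g x - g y) + g y * (f x - f y)" by (simp add: algebra_simps)
    then have "\<bar>f x * g x - f y * g y\<bar> \<le> \<bar>f x\<bar> * \<bar>g x - g y\<bar> + \<bar>g y\<bar> * \<bar>f x - f y\<bar>"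
      by (metis abs_mult abs_triangle_ineq)
    also have "\<dots> \<le> A * (D * \<bar>x - y\<bar> powr \<alpha>) + B * (C * \<bar>x - y\<bar> powr \<alpha>)"
      using A B C D xy by (intro add_mono mult_mono) auto
    finally show ?thesis by (simp add: algebra_simps)
  qed
  then show ?case using 0 by (auto intro: bounded_mult_image)
next
  case (Suc k)
  then obtain f' g' where *: "\<forall>x\<in>S. (f has_real_derivative f' x) (at x)" "bounded_holder k \<alpha> S f'"
    "\<forall>x\<in>S. (g has_real_derivative g' x) (at x)" "bounded_holder k \<alpha> S g'" by auto
  have "bounded_holder k \<alpha> S f" "bounded_holder k \<alpha> S g"
    using Suc.prems bounded_holder_Suc_imp[OF S] by auto
  then have "bounded_holder k \<alpha> S (\<lambda>x. f' x * g x + g' x * f x)"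
    using * Suc.IH by (intro bounded_holder_add) auto
  moreover have "\<forall>x\<in>S. ((\<lambda>x. f x * g x) has_real_derivative (f' x * g x + g' x * f x)) (at x)"
    using * by (auto intro: DERIV_mult)
  ultimately show ?case using Suc.prems by (auto intro!: bounded_mult_image)
qed

lemma bounded_holder_diff:
  assumes "convex S" "0 \<le> \<alpha>" "\<alpha> \<le> 1"
    and "bounded_holder k \<alpha> S f" "bounded_holder k \<alpha> S g"
  shows "bounded_holder k \<alpha> S (\<lambda>x. f x - g x)"
  using bounded_holder_add[OF assms(4) bounded_holder_mult[OF assms(1-3) bounded_holder_const[of k \<alpha> S "-1"] assms(5)]]
  by simp

lemma bounded_holder_exp:
  assumes S: "convex S" "0 \<le> \<alpha>" "\<alpha> \<le> 1" and "bounded_holder k \<alpha> S u"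
  shows "bounded_holder k \<alpha> S (\<lambda>x. exp (u x))"
proof -
  obtain B where B: "B \<ge> 0" "\<And>x. x \<in> S \<Longrightarrow> \<bar>u x\<bar> \<le> B" by (rule bounded_holderD[OF assms(4)]) blast
  have bdd: "bounded ((\<lambda>x. exp (u x)) ` S)"
    unfolding bounded_image_real using B by (intro exI[of _ "exp B"]) (auto simp: abs_le_iff)
  from assms(4) B show ?thesis using bdd
  proof (induction k)
    case 0
    then obtain C where C: "\<forall>x\<in>S. \<forall>y\<in>S. \<bar>u x - u y\<bar> \<le> C * \<bar>x - y\<bar> powr \<alpha>" by auto
    have "\<bar>exp (u x) - exp (u y)\<bar> \<le> exp B * C * \<bar>x - y\<bar> powr \<alpha>" if xy: "x \<in> S" "y \<in> S" for x y
    proof -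
      have "\<bar>exp (u x) - exp (u y)\<bar> \<le> exp B * \<bar>u x - u y\<bar>"
        by (rule lipschitz_if_derivative_bounded[of "{-B..B}" exp exp])
          (use B xy in \<open>auto intro!: derivative_eq_intros simp: abs_le_iff\<close>, force+)
      also have "\<dots> \<le> exp B * (C * \<bar>x - y\<bar> powr \<alpha>)" using C xy by (intro mult_left_mono) auto
      finally show ?thesis by simp
    qed
    then show ?case using 0 by auto
  next
    case (Suc k)
    then obtain u' where *: "\<forall>x\<in>S. (u has_real_derivative u' x) (at x)" "bounded_holder k \<alpha> S u'" by auto
    have "bounded_holder k \<alpha> S (\<lambda>x. exp (u x))"
      using Suc.IH Suc.prems bounded_holder_Suc_imp[OF S] by auto
    then have "bounded_holder k \<alpha> S (\<lambda>x. exp (u x) * u' x)"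
      using * by (intro bounded_holder_mult S) auto
    moreover have "\<forall>x\<in>S. ((\<lambda>x. exp (u x)) has_real_derivative (exp (u x) * u' x)) (at x)"
      using * by (auto intro!: derivative_eq_intros)
    ultimately show ?case using Suc.prems by auto
  qed
qed

lemma bounded_holder_inverse:
  assumes S: "convex S" "0 \<le> \<alpha>" "\<alpha> \<le> 1" and "bounded_holder k \<alpha> S u"
    and d: "d > 0" "\<And>x. x \<in> S \<Longrightarrow> u x \<ge> d"
  shows "bounded_holder k \<alpha> S (\<lambda>x. inverse (u x))"
proof -
  have pos: "u x > 0" if "x \<in> S" for x using d that by force
  have inv: "\<bar>inverse (u x)\<bar> \<le> inverse d" if "x \<in> S" for x
    using d pos[OF that] that by (auto intro!: le_imp_inverse_le simp: abs_of_pos)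
  have bdd: "bounded ((\<lambda>x. inverse (u x)) ` S)"
    unfolding bounded_image_real using inv d by (intro exI[of _ "inverse d"]) auto
  from assms(4) show ?thesis using bdd
  proof (induction k)
    case 0
    then obtain C where C: "\<forall>x\<in>S. \<forall>y\<in>S. \<bar>u x - u y\<bar> \<le> C * \<bar>x - y\<bar> powr \<alpha>" by auto
    have "\<bar>inverse (u x) - inverse (u y)\<bar> \<le> inverse d * inverse d * C * \<bar>x - y\<bar> powr \<alpha>"
      if xy: "x \<in> S" "y \<in> S" for x y
    proof -
      have "inverse (u x) - inverse (u y) = inverse (u x) * inverse (u y) * (u y - u x)"
        using pos[OF xy(1)] pos[OF xy(2)] by (simp add: field_simps)
      then have "\<bar>inverse (u x) - inverse (u y)\<bar> = \<bar>inverse (u x)\<bar> * \<bar>inverse (u y)\<bar> * \<bar>u x - u y\<bar>"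
        by (simp add: abs_mult abs_minus_commute)
      also have "\<dots> \<le> inverse d * inverse d * (C * \<bar>x - y\<bar> powr \<alpha>)"
        using inv xy C d by (intro mult_mono) auto
      finally show ?thesis by simp
    qed
    then show ?case using 0 by auto
  next
    case (Suc k)
    then obtain u' where *: "\<forall>x\<in>S. (u has_real_derivative u' x) (at x)" "bounded_holder k \<alpha> S u'" by auto
    have "bounded_holder k \<alpha> S (\<lambda>x. inverse (u x))"
      using Suc.IH Suc.prems bounded_holder_Suc_imp[OF S] by auto
    then have "bounded_holder k \<alpha> S (\<lambda>x. - 1 * (u' x * (inverse (u x) * inverse (u x))))"
      using * by (intro bounded_holder_mult S bounded_holder_const) auto
    moreover have "\<forall>x\<in>S. ((\<lambda>x. inverse (u x)) has_real_derivative (- 1 * (u' x * (inverse (u x) * inverse (u x))))) (at x)"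
      using * pos by (auto intro!: derivative_eq_intros simp: less_imp_neq[THEN not_sym] power2_eq_square)
    ultimately show ?case using Suc.prems by auto
  qed
qed

lemma bounded_holder_cos_sin:
  assumes S: "convex S" "0 \<le> \<alpha>" "\<alpha> \<le> 1"
  shows "bounded_holder k \<alpha> S (\<lambda>x. cos (x - c))" "bounded_holder k \<alpha> S (\<lambda>x. sin (x - c))"
proof -
  have "bounded_holder k \<alpha> S (\<lambda>x. sin (x - c))" for c
  proof (induction k arbitrary: c)
    case 0
    have "\<bar>sin (x - c) - sin (y - c)\<bar> \<le> 1 * \<bar>x - y\<bar>" for x y
      by (rule lipschitz_if_derivative_bounded[of UNIV "\<lambda>x. sin (x - c)" "\<lambda>x. cos (x - c)"])
        (auto intro!: derivative_eq_intros)
    then show ?case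
      by (intro bounded_holder_0_if_lipschitz[where L = 1] S)
        (auto simp: bounded_image_real intro!: exI[of _ 1])
  next
    case (Suc k)
    have "((\<lambda>x. sin (x - c)) has_real_derivative sin (x - (c - pi / 2))) (at x)" for x
    proof -
      have "sin (x - (c - pi / 2)) = cos (x - c)"
        using sin_add[of "x - c" "pi / 2"] by (simp add: diff_diff_eq2 add_diff_eq diff_add_eq)
      then show ?thesis by (auto intro!: derivative_eq_intros)
    qed
    then show ?case using Suc by (auto simp: bounded_image_real intro!: exI[of _ 1] exI[of _ "\<lambda>x. sin (x - (c - pi / 2))"])
  qed
  note * = this
  show "bounded_holder k \<alpha> S (\<lambda>x. sin (x - c))" by (rule *)
  have "cos (x - c) = sin (x - (c - pi / 2))" for x
    using sin_add[of "x - c" "pi / 2"] by (simp add: diff_diff_eq2 add_diff_eq diff_add_eq)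
  then show "bounded_holder k \<alpha> S (\<lambda>x. cos (x - c))" using *[of "c - pi / 2"] by simp
qed

text \<open>The inverse function of a \<open>C\<^sup>k\<^sup>+\<^sup>1\<^sup>,\<^sup>\<alpha>\<close> function solves \<open>\<tau>' = P(\<tau>)\<close> with \<open>P\<close> only of class \<open>C\<^sup>k\<^sup>,\<^sup>\<alpha>\<close>.
Composition with such a \<open>\<tau>\<close> loses no derivative, because \<open>(Q \<circ> \<tau>)' = (Q' P) \<circ> \<tau>\<close> has the same
shape again; no regularity of \<open>\<tau>\<close> has to be known beforehand.\<close>

lemma bounded_holder_flow:
  assumes S: "convex S" "0 \<le> \<alpha>" "\<alpha> \<le> 1" and R: "convex R" "\<tau> ` S \<subseteq> R"
    and \<tau>: "\<And>s. s \<in> S \<Longrightarrow> (\<tau> has_real_derivative P (\<tau> s)) (at s)"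
    and "bounded_holder k \<alpha> R P" "bounded_holder k \<alpha> R Q"
  shows "bounded_holder k \<alpha> S (\<lambda>s. Q (\<tau> s))"
  using assms(7,8)
proof (induction k arbitrary: Q)
  case 0
  obtain B where B: "B \<ge> 0" "\<And>x. x \<in> R \<Longrightarrow> \<bar>P x\<bar> \<le> B" by (rule bounded_holderD[OF 0(1)]) blast
  obtain C where C: "\<forall>x\<in>R. \<forall>y\<in>R. \<bar>Q x - Q y\<bar> \<le> C * \<bar>x - y\<bar> powr \<alpha>" using 0 by auto
  have "\<bar>Q (\<tau> x) - Q (\<tau> y)\<bar> \<le> \<bar>C\<bar> * B powr \<alpha> * \<bar>x - y\<bar> powr \<alpha>" if xy: "x \<in> S" "y \<in> S" for x y
  proof -
    have "\<bar>\<tau> x - \<tau> y\<bar> \<le> B * \<bar>x - y\<bar>"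
      by (rule lipschitz_if_derivative_bounded[OF S(1) \<tau>]) (use B R xy in auto)
    then have "\<bar>\<tau> x - \<tau> y\<bar> powr \<alpha> \<le> (B * \<bar>x - y\<bar>) powr \<alpha>" using S by (intro powr_mono2) auto
    also have "\<dots> = B powr \<alpha> * \<bar>x - y\<bar> powr \<alpha>" using B by (simp add: powr_mult)
    finally have "\<bar>C\<bar> * \<bar>\<tau> x - \<tau> y\<bar> powr \<alpha> \<le> \<bar>C\<bar> * (B powr \<alpha> * \<bar>x - y\<bar> powr \<alpha>)"
      by (intro mult_left_mono) auto
    moreover have "\<bar>Q (\<tau> x) - Q (\<tau> y)\<bar> \<le> \<bar>C\<bar> * \<bar>\<tau> x - \<tau> y\<bar> powr \<alpha>"
      using C R(2) xy by (meson abs_ge_self image_subset_iff mult_right_mono order_trans powr_ge_zero)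
    ultimately show ?thesis by simp
  qed
  moreover have "bounded ((\<lambda>s. Q (\<tau> s)) ` S)"
    using 0(2) R(2) by (auto intro: bounded_subset)
  ultimately show ?case by auto
next
  case (Suc k)
  then obtain Q' where Q': "\<forall>x\<in>R. (Q has_real_derivative Q' x) (at x)" "bounded_holder k \<alpha> R Q'" by auto
  have P: "bounded_holder k \<alpha> R P" using Suc.prems bounded_holder_Suc_imp[OF R(1) S(2,3)] by auto
  then have "bounded_holder k \<alpha> S (\<lambda>s. Q' (\<tau> s) * P (\<tau> s))"
    using Suc.IH[OF P bounded_holder_mult[OF R(1) S(2,3) Q'(2) P]] by simp
  moreover have "\<forall>s\<in>S. ((\<lambda>s. Q (\<tau> s)) has_real_derivative Q' (\<tau> s) * P (\<tau> s)) (at s)"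
    using \<tau> R Q' by (auto intro!: DERIV_chain2[where f=Q])
  moreover have "bounded ((\<lambda>s. Q (\<tau> s)) ` S)"
    using Suc(3) R(2) by (auto intro: bounded_subset)
  ultimately show ?case by auto
qed

lemma C_holder_on_cong:
  assumes "open S" "\<And>x. x \<in> S \<Longrightarrow> f x = g x" "C_holder_on S k \<alpha> g"
  shows "C_holder_on S k \<alpha> f"
proof -
  have ev: "\<forall>\<^sub>F y in nhds x. f y = g y" if "x \<in> S" for x
    using assms(1,2) that eventually_nhds by blast
  have eq: "(deriv ^^ j) f x = (deriv ^^ j) g x" if "x \<in> S" for j x
    using ev[OF that] by (rule higher_deriv_cong_ev) simp
  have "(deriv ^^ j) f differentiable (at x)" if x: "x \<in> S" and d: "(deriv ^^ j) g differentiable (at x)" for j x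
  proof -
    obtain D where "((deriv ^^ j) g has_derivative D) (at x)" using d by (auto simp: differentiable_def)
    then have "((deriv ^^ j) f has_derivative D) (at x)"
      by (rule has_derivative_transform_within_open[OF _ assms(1) x]) (use eq in auto)
    then show ?thesis by (auto simp: differentiable_def)
  qed
  then show ?thesis
    using assms(3) eq unfolding C_holder_on_def by (auto cong: continuous_on_cong)
qed

lemma C_holder_on_Suc:
  assumes "open S" "\<And>x. x \<in> S \<Longrightarrow> (g has_real_derivative g' x) (at x)" "C_holder_on S k \<alpha> g'"
  shows "C_holder_on S (Suc k) \<alpha> g"
proof -
  have "C_holder_on S k \<alpha> (deriv g)"
    by (rule C_holder_on_cong[OF assms(1) _ assms(3)]) (use assms(2) DERIV_imp_deriv in blast)
  moreover have "g differentiable (at x)" if "x \<in> S" for x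
    using assms(2)[OF that] by (auto simp: differentiable_def has_field_derivative_def)
  ultimately show ?thesis
    unfolding C_holder_on_def
    by (auto simp: funpow_Suc_right less_Suc_eq_0_disj simp del: funpow.simps)
qed

lemma bounded_holder_imp_C_holder_on:
  assumes "0 < \<alpha>" "open S" "bounded_holder k \<alpha> S g"
  shows "C_holder_on S k \<alpha> g"
  using assms(3)
proof (induction k arbitrary: g)
  case 0
  then obtain C where C: "\<And>x y. x\<in>S \<Longrightarrow> y\<in>S \<Longrightarrow> \<bar>g x - g y\<bar> \<le> C * \<bar>x - y\<bar> powr \<alpha>" by auto
  have "continuous_on S g"
    unfolding continuous_on_def
  proof
    fix x assume x: "x \<in> S"
    have "((\<lambda>y. \<bar>y - x\<bar> powr \<alpha>) \<longlongrightarrow> \<bar>x - x\<bar> powr \<alpha>) (at x within S)"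
      using assms(1) by (intro tendsto_powr' tendsto_intros) auto
    then have "((\<lambda>y. C * \<bar>y - x\<bar> powr \<alpha>) \<longlongrightarrow> 0) (at x within S)"
      using tendsto_mult_right_zero[of "\<lambda>y. \<bar>y - x\<bar> powr \<alpha>" _ C] by simp
    then have "((\<lambda>y. g y - g x) \<longlongrightarrow> 0) (at x within S)"
      by (rule Lim_null_comparison[rotated]) (use C x in \<open>auto simp: eventually_at_filter\<close>)
    then show "(g \<longlongrightarrow> g x) (at x within S)" by (simp add: LIM_zero_iff)
  qed
  then show ?case using C by (auto simp: C_holder_on_def)
next
  case (Suc k)
  then show ?case using C_holder_on_Suc[OF assms(2)] by (metis bounded_holder.simps(2))
qed

lemma bounded_range_if_periodic:
  fixes g :: "real \<Rightarrow> real"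
  assumes "T > 0" "\<And>x. g (x + T) = g x" "continuous_on UNIV g"
  shows "bounded (range g)"
proof -
  have per: "g (x + of_int n * T) = g x" for x n
  proof (induction n rule: int_induct[of _ 0])
    case (step1 i)
    then show ?case using assms(2)[of "x + of_int i * T"] by (simp add: algebra_simps)
  next
    case (step2 i)
    then show ?case using assms(2)[of "x + of_int (i - 1) * T"] by (simp add: algebra_simps)
  qed simp
  have "range g \<subseteq> g ` {0..T}"
  proof safe
    fix x
    have "x + of_int (- \<lfloor>x / T\<rfloor>) * T \<in> {0..T}"
      using assms(1) floor_divide_lower[of T x] floor_divide_upper[of T x] by (auto simp: algebra_simps)
    then show "g x \<in> g ` {0..T}" using per[of x "- \<lfloor>x / T\<rfloor>"] by (metis image_eqI)
  qed
  moreover have "bounded (g ` {0..T})"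
    by (intro compact_imp_bounded compact_continuous_image continuous_on_subset[OF assms(3)]) auto
  ultimately show ?thesis by (rule bounded_subset[rotated])
qed

text \<open>A continuous periodic function is bounded, and the derivatives inherit the period.\<close>

lemma periodic_C_holder_imp_bounded_holder:
  assumes "T > 0" "\<And>x. g (x + T) = g x" "C_holder_on UNIV k \<alpha> g"
  shows "bounded_holder k \<alpha> UNIV g"
  using assms(2,3)
proof (induction k arbitrary: g)
  case 0
  then show ?case using bounded_range_if_periodic[OF assms(1), of g] by (auto simp: C_holder_on_def)
next
  case (Suc k)
  have diff: "g differentiable (at x)" for x
    using Suc.prems(2) unfolding C_holder_on_def by (metis UNIV_I funpow_0 zero_less_Suc)
  then have D: "(g has_real_derivative deriv g x) (at x)" for x
    using DERIV_deriv_iff_real_differentiable by blast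
  have "C_holder_on UNIV k \<alpha> (deriv g)"
    using Suc.prems(2) unfolding C_holder_on_def
    by (auto simp: funpow_Suc_right simp del: funpow.simps)
  moreover have "deriv g (x + T) = deriv g x" for x
  proof -
    have "((\<lambda>x. g (x + T)) has_real_derivative deriv g (x + T)) (at x)"
      using D[of "x + T"] by (simp add: DERIV_shift)
    then show ?thesis using Suc.prems(1) D[of x] DERIV_unique by simp
  qed
  ultimately have "bounded_holder k \<alpha> UNIV (deriv g)" using Suc.IH by blast
  moreover have "continuous_on UNIV g"
    using D by (meson DERIV_continuous continuous_at_imp_continuous_on)
  ultimately show ?case
    using D bounded_range_if_periodic[OF assms(1), of g] Suc.prems(1) by auto
qed

section \<open>Solutions of Lipschitz initial value problems\<close>

text \<open>Existence by the contraction principle.  The unknown is \<open>w(t) = e\<^sup>-\<^sup>l\<^sup>t x(t)\<close>: with \<open>l\<close> at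
least twice the Lipschitz constant, the integral operator is a contraction with factor \<open>1/2\<close> however
long the time interval is.  The initial value enters the operator additively, so the fixed point is a
Lipschitz function of it.\<close>

lemma picard_flow:
  fixes V :: "real \<Rightarrow> 'a::banach \<Rightarrow> 'a"
  assumes T: "0 \<le> T"
    and cont: "continuous_on ({0..T} \<times> UNIV) (\<lambda>(t, z). V t z)"
    and lip: "\<And>t z w. t \<in> {0..T} \<Longrightarrow> norm (V t z - V t w) \<le> L * norm (z - w)"
  obtains X where "\<And>z. X z 0 = z"
    and "\<And>z t. t \<in> {0..T} \<Longrightarrow> (X z has_vector_derivative V t (X z t)) (at t within {0..T})"
    and "\<And>t. t \<in> {0..T} \<Longrightarrow> continuous_on UNIV (\<lambda>z. X z t)"
proof -
  define l where "l = 2 * (\<bar>L\<bar> + 1)"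
  have l: "l > 0" by (simp add: l_def)
  have lip': "norm (V t z - V t w) \<le> l / 2 * norm (z - w)" if "t \<in> {0..T}" for t z w
    using lip[OF that, of z w] by (rule order_trans) (intro mult_right_mono, auto simp: l_def)
  \<comment> \<open>Clamping time to \<open>{0..T}\<close> lets functions on the interval live in
    the complete space of bounded continuous functions on the line.\<close>
  define c :: "real \<Rightarrow> real" where "c t = max 0 (min T t)" for t
  have c: "c t \<in> {0..T}" for t using T by (auto simp: c_def)
  have c_id: "c t = t" if "t \<in> {0..T}" for t using that by (auto simp: c_def)
  have c_cont: "continuous_on UNIV c" unfolding c_def by (intro continuous_intros)
  define S where "S w s = V s (exp (l * s) *\<^sub>R apply_bcontfun w s)" for w :: "real \<Rightarrow>\<^sub>C 'a" and s
  have S_cont: "continuous_on {0..T} (S w)" for w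
  proof -
    have "continuous_on {0..T} (\<lambda>s. (s, exp (l * s) *\<^sub>R apply_bcontfun w s))"
      by (intro continuous_intros) auto
    then show ?thesis
      unfolding S_def using continuous_on_compose2[OF cont, of "{0..T}" "\<lambda>s. (s, exp (l * s) *\<^sub>R apply_bcontfun w s)"]
      by auto
  qed
  have S_int: "S w integrable_on {0..t}" if "t \<in> {0..T}" for w t
    by (rule integrable_continuous_real) (use that in \<open>auto intro: continuous_on_subset[OF S_cont]\<close>)
  define Q where "Q z w t = exp (- l * t) *\<^sub>R (z + integral {0..t} (S w))" for z w t
  have Q_cont: "continuous_on {0..T} (Q z w)" for z w
    unfolding Q_def
    by (intro continuous_intros indefinite_integral_continuous_1 S_int) (use T in auto)
  have PQ: "(\<lambda>t. Q z w (c t)) \<in> bcontfun" for z w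
  proof -
    have "continuous_on UNIV (\<lambda>t. Q z w (c t))"
      using c by (intro continuous_on_compose2[OF Q_cont c_cont]) auto
    moreover have "bounded (Q z w ` {0..T})"
      by (intro compact_imp_bounded compact_continuous_image Q_cont) auto
    then have "bounded (range (\<lambda>t. Q z w (c t)))"
      by (rule bounded_subset) (use c in auto)
    ultimately show ?thesis by (simp add: bcontfun_def)
  qed
  define P where "P z w = Bcontfun (\<lambda>t. Q z w (c t))" for z w
  have P: "apply_bcontfun (P z w) t = Q z w (c t)" for z w t
    unfolding P_def by (simp add: Bcontfun_inverse[OF PQ])
  \<comment> \<open>For \<open>z = z'\<close> this is the contraction property; at the fixed
    points of two initial values, absorbing the last term gives the dependence on the initial
    value.\<close>
  have est: "dist (P z w) (P z' w') \<le> norm (z - z') + 1 / 2 * dist w w'" for z z' w w'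
  proof (rule dist_bound)
    fix t0
    define t where "t = c t0"
    have t: "t \<in> {0..T}" "0 \<le> t" using c[of t0] by (auto simp: t_def)
    let ?d = "dist w w'"
    have pw: "norm (S w s - S w' s) \<le> ?d / 2 * (l * exp (l * s))" if "s \<in> {0..t}" for s
    proof -
      have "norm (S w s - S w' s) \<le> l / 2 * norm (exp (l * s) *\<^sub>R apply_bcontfun w s - exp (l * s) *\<^sub>R apply_bcontfun w' s)"
        unfolding S_def by (rule lip') (use that t in auto)
      also have "\<dots> = l / 2 * (exp (l * s) * dist (apply_bcontfun w s) (apply_bcontfun w' s))"
        by (simp add: dist_norm flip: scaleR_diff_right)
      also have "\<dots> \<le> l / 2 * (exp (l * s) * ?d)"
        using l by (intro mult_left_mono dist_bounded) auto
      finally show ?thesis by (simp add: mult_ac)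
    qed
    have I: "((\<lambda>s. ?d / 2 * (l * exp (l * s))) has_integral ?d / 2 * exp (l * t) - ?d / 2 * exp (l * 0)) {0..t}"
      using t by (intro fundamental_theorem_of_calculus)
        (auto intro!: derivative_eq_intros simp flip: has_real_derivative_iff_has_vector_derivative)
    have "norm (integral {0..t} (S w) - integral {0..t} (S w')) = norm (integral {0..t} (\<lambda>s. S w s - S w' s))"
      by (subst integral_diff) (auto intro: S_int t)
    also have "\<dots> \<le> integral {0..t} (\<lambda>s. ?d / 2 * (l * exp (l * s)))"
      using pw I by (intro integral_norm_bound_integral integrable_diff S_int t) auto
    also have "\<dots> = ?d / 2 * exp (l * t) - ?d / 2"
      by (subst integral_unique[OF I]) simp
    finally have J: "norm (integral {0..t} (S w) - integral {0..t} (S w')) \<le> ?d / 2 * exp (l * t)"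
      by (smt (verit) zero_le_dist divide_nonneg_pos)
    have "dist (Q z w t) (Q z' w' t) =
      exp (- l * t) * norm ((z - z') + (integral {0..t} (S w) - integral {0..t} (S w')))"
      unfolding Q_def dist_norm scaleR_diff_right[symmetric] norm_scaleR by (simp add: algebra_simps)
    also have "\<dots> \<le> exp (- l * t) * (norm (z - z') + ?d / 2 * exp (l * t))"
      by (intro mult_left_mono norm_triangle_mono J) auto
    also have "\<dots> = exp (- l * t) * norm (z - z') + ?d / 2"
      by (simp add: algebra_simps exp_minus)
    also have "\<dots> \<le> 1 * norm (z - z') + ?d / 2"
      using t l by (intro add_right_mono mult_right_mono) auto
    finally show "dist (apply_bcontfun (P z w) t0) (apply_bcontfun (P z' w') t0) \<le> norm (z - z') + 1 / 2 * ?d"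
      by (simp add: P t_def)
  qed
  have "\<exists>!w. P z w = w" for z
    by (rule banach_fix_type[of "1/2"]) (use est[of z _ z] in auto)
  then obtain w where w: "\<And>z. P z (w z) = w z" by metis
  have w_lip: "dist (w z) (w z') \<le> 2 * norm (z - z')" for z z'
    using est[of z "w z" z' "w z'"] by (simp add: w)
  define X where "X z t = exp (l * t) *\<^sub>R apply_bcontfun (w z) t" for z t
  have SX: "S (w z) s = V s (X z s)" for z s by (simp add: S_def X_def)
  have X: "X z t = z + integral {0..t} (S (w z))" if "t \<in> {0..T}" for z t
  proof -
    have "apply_bcontfun (w z) t = Q z (w z) t"
      using P[of z "w z" t] by (simp add: w c_id[OF that])
    then show ?thesis by (simp add: X_def Q_def flip: exp_add)
  qed
  show thesis
  proof (rule that[of X])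
    show "X z 0 = z" for z using X[of 0 z] T by simp
    show "(X z has_vector_derivative V t (X z t)) (at t within {0..T})" if t: "t \<in> {0..T}" for z t
    proof -
      have "((\<lambda>u. z + integral {0..u} (S (w z))) has_vector_derivative (0 + S (w z) t)) (at t within {0..T})"
        by (intro derivative_intros integral_has_vector_derivative S_cont t)
      then have "((\<lambda>u. z + integral {0..u} (S (w z))) has_vector_derivative V t (X z t)) (at t within {0..T})"
        by (simp add: SX)
      then show ?thesis
        by (rule has_vector_derivative_transform[OF t, rotated]) (use X in auto)
    qed
    show "continuous_on UNIV (\<lambda>z. X z t)" for t
    proof -
      have "dist (X z t) (X z' t) \<le> exp (l * t) * 2 * dist z z'" for z z'
      proof -
        have "dist (X z t) (X z' t) = exp (l * t) * dist (apply_bcontfun (w z) t) (apply_bcontfun (w z') t)"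
          by (simp add: X_def dist_norm flip: scaleR_diff_right)
        also have "\<dots> \<le> exp (l * t) * (2 * norm (z - z'))"
          using order_trans[OF dist_bounded w_lip] by (intro mult_left_mono) auto
        finally show ?thesis by (simp add: dist_norm)
      qed
      then show ?thesis
        by (intro lipschitz_on_continuous_on[of "exp (l * t) * 2"] lipschitz_onI) auto
    qed
  qed
qed

section \<open>A lower bound for Gaussian-weighted length\<close>

text \<open>The Gaussian factor \<open>exp (|z|^2 / 2)\<close> of the equation, frozen outside the unit disc.  This makes the
equation globally Lipschitz, and it changes nothing for a solution that stays in the disc.\<close>

definition clipped_weight :: "complex \<Rightarrow> real" where
  "clipped_weight z = exp ((min (cmod z) 1)\<^sup>2 / 2)"

lemma clipped_weight_pos: "clipped_weight z > 0"
  by (simp add: clipped_weight_def)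

lemma clipped_weight_le: "clipped_weight z \<le> 1.65"
proof -
  have "(min (cmod z) 1)\<^sup>2 \<le> 1" by (intro power_le_one) auto
  \<comment> \<open>The number \<open>1.65\<close> is a convenient upper bound of the square root
    of \<open>e\<close>.\<close>
  then have "clipped_weight z \<le> exp (1 / 2)" by (simp add: clipped_weight_def)
  also have "\<dots> \<le> 1.65"
  proof (rule power2_le_imp_le)
    have "(exp (1 / 2))\<^sup>2 = exp (1::real)" by (simp flip: exp_of_nat_mult)
    then show "(exp (1 / 2 :: real))\<^sup>2 \<le> 1.65\<^sup>2" using e_less_272 by (simp add: power2_eq_square)
  qed simp
  finally show ?thesis .
qed

lemma clipped_weight_lipschitz: "\<bar>clipped_weight z - clipped_weight w\<bar> \<le> exp 1 * cmod (z - w)"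
proof -
  define a b where "a = min (cmod z) 1" and "b = min (cmod w) 1"
  have ab: "0 \<le> a" "a \<le> 1" "0 \<le> b" "b \<le> 1" by (auto simp: a_def b_def)
  have "\<bar>exp (a\<^sup>2 / 2) - exp (b\<^sup>2 / 2)\<bar> \<le> exp 1 * \<bar>a - b\<bar>"
  proof -
    have "norm (exp (a\<^sup>2 / 2) - exp (b\<^sup>2 / 2)) \<le> exp 1 * norm (a - b)"
    proof (rule field_differentiable_bound[of "{0..1}"])
      show "((\<lambda>a. exp (a\<^sup>2 / 2)) has_real_derivative exp (t\<^sup>2 / 2) * t) (at t within {0..1})" for t :: real
        by (auto intro!: derivative_eq_intros)
      show "norm (exp (t\<^sup>2 / 2) * t) \<le> exp 1" if "t \<in> {0..1}" for t :: real
      proof -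
        have "t\<^sup>2 \<le> 1" using that by (intro power_le_one) auto
        then have "exp (t\<^sup>2 / 2) * t \<le> exp 1 * 1" using that by (intro mult_mono) auto
        then show ?thesis using that by simp
      qed
    qed (use ab in auto)
    then show ?thesis by simp
  qed
  also have "\<dots> \<le> exp 1 * cmod (z - w)"
    using norm_triangle_ineq3[of z w] by (intro mult_left_mono) (auto simp: a_def b_def)
  finally show ?thesis by (simp add: clipped_weight_def a_def b_def)
qed

text \<open>The linear form in \<open>w\<close> is the differential at \<open>q = x + iy\<close> of \<open>\<psi> = 0.66 x - 0.02 x\<^sup>3 - 0.06 x y\<^sup>2\<close>.
The statement says that \<open>\<psi>\<close> has Lipschitz constant \<open>1\<close> for the length element
\<open>|dq| / clipped_weight(q)\<close> as long as \<open>|q|\<^sup>2 \<le> 10\<close>; hence \<open>\<psi>\<close> bounds this length from below.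

Because \<open>\<psi>\<^sub>x\<close> depends on \<open>s = |q|\<^sup>2\<close> only, and \<open>\<psi>\<^sub>y\<^sup>2 = (0.12 x y)\<^sup>2 \<le> (0.06 s)\<^sup>2\<close>, the squared gradient
is at most a quadratic polynomial \<open>Q\<close> in \<open>s\<close>, which has to stay below \<open>exp (- min s 1)\<close>.  On \<open>[0, 1]\<close>
this is compared with the tangent line of \<open>exp (- s)\<close> at \<open>1\<close>; on \<open>[1, 10]\<close> convexity leaves the two
end points, where \<open>Q = 0.3636 < 1/e\<close>.\<close>

lemma calibration_gradient:
  fixes q w :: complex
  assumes "cmod q ^ 2 \<le> 10"
  shows "\<bar>(0.66 - 0.06 * (cmod q)\<^sup>2) * Re w - 0.12 * Re q * Im q * Im w\<bar> * clipped_weight q \<le> cmod w"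
proof -
  define s where "s = (cmod q)\<^sup>2"
  define E where "E = clipped_weight q"
  have s: "0 \<le> s" "s \<le> 10" "s = (Re q)\<^sup>2 + (Im q)\<^sup>2"
    using assms by (auto simp: s_def cmod_power2)
  have E: "E > 0" "E\<^sup>2 = exp (min s 1)"
  proof -
    have "E\<^sup>2 = exp ((min (cmod q) 1)\<^sup>2)" by (simp add: E_def clipped_weight_def flip: exp_of_nat_mult)
    also have "(min (cmod q) 1)\<^sup>2 = min s 1"
      by (auto simp: s_def min_def abs_square_le_1)
    finally show "E\<^sup>2 = exp (min s 1)" .
  qed (simp add: E_def clipped_weight_pos)
  define Q where "Q = (0.66 - 0.06 * s)\<^sup>2 + 0.0036 * s\<^sup>2"
  have Q_eq: "Q = 0.4356 - 0.0792 * s + 0.0072 * s\<^sup>2"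
    by (simp add: Q_def power2_eq_square algebra_simps)
  have QE: "Q * E\<^sup>2 \<le> 1"
  proof (cases "s \<le> 1")
    case True
    have "s\<^sup>2 \<le> s * 1" unfolding power2_eq_square using s True by (intro mult_left_mono) auto
    then have "2.72 * Q \<le> 2 - s" unfolding Q_eq using s(1) True by simp
    also have "2 - s \<le> exp (1 - s)" using exp_ge_add_one_self[of "1 - s"] by simp
    finally have "2.72 * Q * exp s \<le> exp (1 - s) * exp s" by (intro mult_right_mono) auto
    also have "\<dots> \<le> 2.72 * 1" using e_less_272 by (simp flip: exp_add)
    finally have "2.72 * (Q * exp s) \<le> 2.72 * 1" by (simp add: mult_ac)
    then show ?thesis unfolding E(2) using True by simp
  next
    case False
    \<comment> \<open>\<open>Q\<close> takes the value \<open>0.3636\<close> at \<open>s =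
      1\<close> and at \<open>s = 10\<close>, so \<open>0.3636 - Q\<close> is a positive multiple
      of \<open>(s - 1) (10 - s)\<close>.\<close>
    have "(s - 1) * (10 - s) \<ge> 0" using False s by (intro mult_nonneg_nonneg) auto
    then have "Q \<le> 0.3636" unfolding Q_eq by (simp add: power2_eq_square algebra_simps)
    moreover have "E\<^sup>2 \<le> 2.72" unfolding E(2) using False e_less_272 by simp
    ultimately have "Q * E\<^sup>2 \<le> 0.3636 * 2.72" by (intro mult_mono) auto
    then show ?thesis by simp
  qed
  have grad: "(0.66 - 0.06 * s)\<^sup>2 + (0.12 * Re q * Im q)\<^sup>2 \<le> Q"
  proof -
    have "4 * ((Re q)\<^sup>2 * (Im q)\<^sup>2) \<le> s\<^sup>2"
      using zero_le_power2[of "(Re q)\<^sup>2 - (Im q)\<^sup>2"] by (simp add: s(3) power2_eq_square algebra_simps)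
    then show ?thesis by (simp add: Q_def power_mult_distrib power2_eq_square mult_ac)
  qed
  have "(A * x - B * y)\<^sup>2 \<le> (A\<^sup>2 + B\<^sup>2) * (x\<^sup>2 + y\<^sup>2)" for A B x y :: real
    using zero_le_power2[of "A * y + B * x"] by (simp add: power2_eq_square algebra_simps)
  then have "((0.66 - 0.06 * s) * Re w - (0.12 * Re q * Im q) * Im w)\<^sup>2
      \<le> ((0.66 - 0.06 * s)\<^sup>2 + (0.12 * Re q * Im q)\<^sup>2) * ((Re w)\<^sup>2 + (Im w)\<^sup>2)" .
  also have "\<dots> \<le> Q * (cmod w)\<^sup>2"
    unfolding cmod_power2[of w] using grad by (intro mult_right_mono) auto
  finally have "((0.66 - 0.06 * s) * Re w - (0.12 * Re q * Im q) * Im w)\<^sup>2 * E\<^sup>2 \<le> Q * (cmod w)\<^sup>2 * E\<^sup>2"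
    by (intro mult_right_mono) auto
  also have "\<dots> \<le> 1 * (cmod w)\<^sup>2"
    using mult_right_mono[OF QE, of "(cmod w)\<^sup>2"] by (simp add: mult_ac)
  finally have "(\<bar>(0.66 - 0.06 * s) * Re w - (0.12 * Re q * Im q) * Im w\<bar> * E)\<^sup>2 \<le> (cmod w)\<^sup>2"
    by (simp add: power_mult_distrib)
  then have "\<bar>(0.66 - 0.06 * s) * Re w - (0.12 * Re q * Im q) * Im w\<bar> * E \<le> cmod w"
    by (rule power2_le_imp_le) simp
  then show ?thesis by (simp add: s_def E_def)
qed

text \<open>This replaces the Gaussian isoperimetric inequality.  A curve from a unit vector to a
point \<open>- c\<close> times that vector has length at least \<open>\<psi>(1) - \<psi>(-c) \<ge> 2 \<psi>(1) = 1.28\<close> in the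
weighted metric, where \<open>\<psi>\<close> is the calibration above in coordinates rotated so that the curve
starts at \<open>1\<close>.  The straight estimate \<open>|y b - y a| \<ge> 2\<close> with the constant weight \<open>exp (- 1/2)\<close> would only
give \<open>1.21\<close>, which is less than the needed \<open>sqrt (\<pi>/2)\<close>, about \<open>1.2533\<close>.\<close>

lemma no_short_crossing:
  fixes y :: "real \<Rightarrow> complex"
  assumes ab: "a < b"
    and y: "\<And>t. t \<in> {a..b} \<Longrightarrow> (y has_vector_derivative v t) (at t within {a..b})"
    and F: "continuous_on {a..b} F" "integral {a..b} F < 1.28"
    and speed: "\<And>t. t \<in> {a..b} \<Longrightarrow> cmod (v t) \<le> F t * clipped_weight (y t)"
    and ya: "cmod (y a) = 1" and yb: "y b = - (c *\<^sub>R y a)" and c: "c \<ge> 1"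
  shows False
proof -
  define \<Phi> where "\<Phi> t = integral {a..t} F" for t
  have \<Phi>D: "(\<Phi> has_vector_derivative F t) (at t within {a..b})" if "t \<in> {a..b}" for t
    unfolding \<Phi>_def by (rule integral_has_vector_derivative[OF F(1) that])
  have interior: "at t within {a..b} = at t" if "a < t" "t < b" for t
    using that by (intro at_within_interior) auto
  have \<Phi>_cont: "continuous_on {a..b} \<Phi>"
    using \<Phi>D by (meson continuous_on_eq_continuous_within has_vector_derivative_continuous)
  have \<Phi>a: "\<Phi> a = 0" by (simp add: \<Phi>_def)
  have F0: "F t \<ge> 0" if "t \<in> {a..b}" for t
    using order_trans[OF norm_ge_zero speed[OF that]] clipped_weight_pos[of "y t"]
    by (simp add: zero_le_mult_iff)
  have \<Phi>_le: "\<Phi> t \<le> \<Phi> b" if "t \<in> {a..b}" for t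
    unfolding \<Phi>_def using that F0
    by (intro integral_subset_le integrable_continuous_real continuous_on_subset[OF F(1)]) auto
  have \<Phi>b: "\<Phi> b < 1.28" using F by (simp add: \<Phi>_def)
  have y_cont: "continuous_on {a..b} y"
    using y by (meson continuous_on_eq_continuous_within has_vector_derivative_continuous)
  \<comment> \<open>The Euclidean length is at most \<open>1.65 \<cdot> 1.28 = 2.112\<close>, so
    the curve stays where the calibration is valid: \<open>3.112\<^sup>2 < 10\<close>.\<close>
  have far: "cmod (y t) \<le> 3.112" if t: "t \<in> {a..b}" for t
  proof (cases "t = a")
    case False
    have "norm (y t - y a) \<le> 1.65 * \<Phi> t - 1.65 * \<Phi> a"
    proof (rule differentiable_bound_general[where f' = v and \<phi>' = "\<lambda>t. 1.65 * F t"])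
      show "a < t" using t False by simp
      show "continuous_on {a..t} y" by (rule continuous_on_subset[OF y_cont]) (use t in auto)
      show "continuous_on {a..t} (\<lambda>t. 1.65 * \<Phi> t)"
        by (intro continuous_intros continuous_on_subset[OF \<Phi>_cont]) (use t in auto)
      fix s assume s: "a < s" "s < t"
      then have s': "s \<in> {a..b}" "s < b" using t by auto
      show "(y has_vector_derivative v s) (at s)" using y[OF s'(1)] interior s s' by simp
      show "((\<lambda>t. 1.65 * \<Phi> t) has_vector_derivative 1.65 * F s) (at s)"
        using \<Phi>D[OF s'(1)] interior[of s] s s' by (auto intro!: derivative_eq_intros)
      have "F s * clipped_weight (y s) \<le> F s * 1.65"
        using F0[OF s'(1)] clipped_weight_le by (intro mult_left_mono)
      then show "norm (v s) \<le> 1.65 * F s" using speed[OF s'(1)] by simp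
    qed
    then show ?thesis
      using \<Phi>_le[OF t] \<Phi>b norm_triangle_sub[of "y t" "y a"] ya \<Phi>a by simp
  qed (use ya in simp)
  define q where "q t = y t * cnj (y a)" for t
  have q_norm: "cmod (q t) = cmod (y t)" for t by (simp add: q_def norm_mult ya)
  have qD: "(q has_vector_derivative v t * cnj (y a)) (at t within {a..b})" if "t \<in> {a..b}" for t
    unfolding q_def using y[OF that] by (auto intro!: derivative_eq_intros)
  define \<psi> where "\<psi> z = 0.66 * Re z - 0.02 * (Re z)^3 - 0.06 * Re z * (Im z)\<^sup>2" for z
  define g where "g t = (0.66 - 0.06 * (cmod (q t))\<^sup>2) * Re (v t * cnj (y a))
    - 0.12 * Re (q t) * Im (q t) * Im (v t * cnj (y a))" for t
  have \<psi>D: "((\<lambda>t. \<psi> (q t)) has_vector_derivative g t) (at t within {a..b})" if t: "t \<in> {a..b}" for t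
  proof -
    have R: "((\<lambda>t. Re (q t)) has_real_derivative Re (v t * cnj (y a))) (at t within {a..b})"
      and I: "((\<lambda>t. Im (q t)) has_real_derivative Im (v t * cnj (y a))) (at t within {a..b})"
      unfolding has_real_derivative_iff_has_vector_derivative
      using bounded_linear.has_vector_derivative[OF bounded_linear_Re qD[OF t]]
        bounded_linear.has_vector_derivative[OF bounded_linear_Im qD[OF t]] by auto
    have "((\<lambda>t. 0.66 * u t - 0.02 * (u t)^3 - 0.06 * u t * (w t)\<^sup>2) has_real_derivative
        (0.66 - 0.06 * ((u t)\<^sup>2 + (w t)\<^sup>2)) * u' - 0.12 * u t * w t * w') (at t within {a..b})"
      if "(u has_real_derivative u') (at t within {a..b})" "(w has_real_derivative w') (at t within {a..b})"
      for u w u' w'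
      using that by (auto intro!: derivative_eq_intros simp: algebra_simps power2_eq_square add_divide_distrib)
    from this[OF R I] show ?thesis
      by (simp add: \<psi>_def g_def cmod_power2 has_real_derivative_iff_has_vector_derivative)
  qed
  have "norm (\<psi> (q b) - \<psi> (q a)) \<le> \<Phi> b - \<Phi> a"
  proof (rule differentiable_bound_general[where f' = g and \<phi>' = F])
    show "continuous_on {a..b} (\<lambda>t. \<psi> (q t))"
      using \<psi>D by (meson continuous_on_eq_continuous_within has_vector_derivative_continuous)
    fix t assume t: "a < t" "t < b"
    then have t': "t \<in> {a..b}" by simp
    show "((\<lambda>t. \<psi> (q t)) has_vector_derivative g t) (at t)"
      "(\<Phi> has_vector_derivative F t) (at t)"
      using \<psi>D[OF t'] \<Phi>D[OF t'] interior[OF t] by auto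
    have "(cmod (q t))\<^sup>2 \<le> 3.112\<^sup>2" unfolding q_norm by (intro power_mono far t') auto
    then have "\<bar>g t\<bar> * clipped_weight (q t) \<le> cmod (v t * cnj (y a))"
      unfolding g_def by (intro calibration_gradient) (simp add: power2_eq_square)
    also have "\<dots> \<le> F t * clipped_weight (q t)"
      using speed[OF t'] by (simp add: norm_mult ya clipped_weight_def q_norm)
    finally show "norm (g t) \<le> F t" using clipped_weight_pos[of "q t"] by simp
  qed (use ab \<Phi>_cont in auto)
  moreover have "q a = 1" by (simp add: q_def ya flip: complex_norm_square)
  then have "\<psi> (q a) = 0.64" by (simp add: \<psi>_def)
  moreover have "q b = - complex_of_real c"
    using \<open>q a = 1\<close> by (simp add: q_def yb scaleR_conv_of_real mult.assoc)
  then have "\<psi> (q b) = - (0.66 * c - 0.02 * c^3)" by (simp add: \<psi>_def)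
  \<comment> \<open>For large \<open>c\<close> the cubic term would win, but \<open>c\<close> is
    the modulus of a point of the curve.\<close>
  moreover have "0.66 * c - 0.02 * c^3 \<ge> 0.64"
  proof -
    have "c = cmod (y b)" using yb ya c by simp
    then have "c \<le> 4" using far[of b] ab by simp
    then have "c * c \<le> 4 * 4" using c by (intro mult_mono) auto
    then have "(c - 1) * (0.66 - 0.02 * (c * c + c + 1)) \<ge> 0"
      using c \<open>c \<le> 4\<close> by (intro mult_nonneg_nonneg) auto
    then show ?thesis by (simp add: algebra_simps power3_eq_cube diff_divide_distrib)
  qed
  ultimately show False using \<Phi>b \<Phi>a by simp
qed

section \<open>Antiperiodic solutions inside the unit disc\<close>

text \<open>The field is invariant under the time shift by \<open>T\<close> combined with \<open>z \<mapsto> - z\<close>, so the translates of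
\<open>y\<close>, taken with alternating signs, fit together to a solution on the whole line: at the junctions
both one-sided derivatives are the value of the field.\<close>

lemma antiperiodic_extension:
  fixes y :: "real \<Rightarrow> 'a::real_normed_vector"
  assumes T: "T > 0"
    and y: "\<And>t. t \<in> {0..T} \<Longrightarrow> (y has_vector_derivative V t (y t)) (at t within {0..T})"
    and yT: "y T = - y 0"
    and V: "\<And>t z. V (t + T) (- z) = - V t z"
  obtains x where "\<And>t. (x has_vector_derivative V t (x t)) (at t)"
    and "\<And>t. x (t + T) = - x t" and "x 0 = y 0"
proof -
  define \<sigma> :: "int \<Rightarrow> real" where "\<sigma> n = (if even n then 1 else - 1)" for n
  have \<sigma>1: "\<sigma> (n + 1) = - \<sigma> n" "\<sigma> (1 + n) = - \<sigma> n" for n by (simp_all add: \<sigma>_def)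
  define x where "x t = \<sigma> \<lfloor>t / T\<rfloor> *\<^sub>R y (t - of_int \<lfloor>t / T\<rfloor> * T)" for t
  have V\<sigma>: "V (t + of_int n * T) (\<sigma> n *\<^sub>R z) = \<sigma> n *\<^sub>R V t z" for t n z
  proof (induction n rule: int_induct[of _ 0])
    case base
    show ?case by (simp add: \<sigma>_def)
  next
    case (step1 i)
    then show ?case using V[of "t + of_int i * T" "\<sigma> i *\<^sub>R z"] by (simp add: \<sigma>1 algebra_simps)
  next
    case (step2 i)
    have "\<sigma> i = - \<sigma> (i - 1)" using \<sigma>1(1)[of "i - 1"] by simp
    with step2 show ?case
      using V[of "t + of_int (i - 1) * T" "\<sigma> (i - 1) *\<^sub>R z"] by (simp add: algebra_simps)
  qed
  have x_eq: "x s = \<sigma> n *\<^sub>R y (s - of_int n * T)" if "s \<in> {of_int n * T..of_int (n + 1) * T}" for s n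
  proof (cases "s = of_int (n + 1) * T")
    case True
    then have "s / T = of_int (n + 1)" "s - of_int (n + 1) * T = 0" "s - of_int n * T = T"
      using T by (simp, simp, simp add: algebra_simps)
    moreover from this(1) have "\<lfloor>s / T\<rfloor> = n + 1" by (simp only: floor_of_int)
    ultimately have "\<lfloor>s / T\<rfloor> = n + 1" "s - of_int (n + 1) * T = 0" "s - of_int n * T = T" by blast+
    then show ?thesis by (simp add: x_def \<sigma>1 yT)
  next
    case False
    then have "\<lfloor>s / T\<rfloor> = n" using that T by (intro floor_unique) (auto simp: field_simps)
    then show ?thesis by (simp add: x_def)
  qed
  have der: "(x has_vector_derivative V t (x t)) (at t within {of_int n * T..of_int (n + 1) * T})"
    if t: "t \<in> {of_int n * T..of_int (n + 1) * T}" for t n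
  proof -
    let ?I = "{of_int n * T..of_int (n + 1) * T}"
    have "(y has_vector_derivative V (t - of_int n * T) (y (t - of_int n * T)))
        (at (t - of_int n * T) within (\<lambda>s. s - of_int n * T) ` ?I)"
      by (rule has_vector_derivative_within_subset[OF y]) (use t in \<open>auto simp: algebra_simps\<close>)
    then have "((y \<circ> (\<lambda>s. s - of_int n * T)) has_vector_derivative
        1 *\<^sub>R V (t - of_int n * T) (y (t - of_int n * T))) (at t within ?I)"
      by (intro vector_diff_chain_within) (auto intro!: derivative_eq_intros)
    then have "((\<lambda>s. \<sigma> n *\<^sub>R y (s - of_int n * T)) has_vector_derivative
        \<sigma> n *\<^sub>R V (t - of_int n * T) (y (t - of_int n * T))) (at t within ?I)"
      by (auto simp: o_def intro!: derivative_eq_intros)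
    moreover have "\<sigma> n *\<^sub>R V (t - of_int n * T) (y (t - of_int n * T)) = V t (x t)"
      using V\<sigma>[of "t - of_int n * T" n "y (t - of_int n * T)"] x_eq[OF t] by simp
    ultimately show ?thesis
      by (metis (no_types, lifting) has_vector_derivative_transform[OF t] x_eq)
  qed
  have glue: "(f has_vector_derivative d) (at s within A \<union> B)"
    if "(f has_vector_derivative d) (at s within A)" "(f has_vector_derivative d) (at s within B)"
    for f :: "real \<Rightarrow> 'a" and d s A B
    using that unfolding has_vector_derivative_def has_derivative_within by (auto simp: Lim_within_Un)
  have D: "(x has_vector_derivative V t (x t)) (at t)" for t
  proof -
    define n where "n = \<lfloor>t / T\<rfloor>"
    have n: "of_int n * T \<le> t" "t < of_int (n + 1) * T"
      using T floor_divide_lower[of T t] floor_divide_upper[of T t] by (auto simp: n_def)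
    show ?thesis
    proof (cases "t = of_int n * T")
      case False
      have "at t within {of_int n * T..of_int (n + 1) * T} = at t"
        by (rule at_within_interior) (use n False in auto)
      then show ?thesis using der[of t n] n by simp
    next
      case True
      let ?A = "{of_int (n - 1) * T..of_int n * T}" and ?B = "{of_int n * T..of_int (n + 1) * T}"
      have "?A \<union> ?B = {of_int (n - 1) * T..of_int (n + 1) * T}"
        using T by (intro ivl_disj_un_two_touch) (auto simp: mult_right_mono)
      then have "at t within (?A \<union> ?B) = at t"
        using T True by (auto intro!: at_within_interior simp: algebra_simps)
      moreover have "(x has_vector_derivative V t (x t)) (at t within ?A)"
        using der[of t "n - 1"] True T by (auto simp: algebra_simps)
      moreover have "(x has_vector_derivative V t (x t)) (at t within ?B)"
        using der[of t n] n by auto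
      ultimately show ?thesis using glue[of x _ t ?A ?B] by metis
    qed
  qed
  show thesis
  proof (rule that[OF D])
    show "x (t + T) = - x t" for t
    proof -
      have "\<lfloor>(t + T) / T\<rfloor> = \<lfloor>t / T\<rfloor> + 1" using T by (simp add: add_divide_distrib)
      then show ?thesis by (simp add: x_def \<sigma>1 algebra_simps)
    qed
    show "x 0 = y 0" by (simp add: x_def \<sigma>_def)
  qed
qed

lemma integral_periodic:
  fixes F :: "real \<Rightarrow> real"
  assumes F: "continuous_on UNIV F" "\<And>t. F (t + T) = F t" and T: "T > 0"
  shows "integral {a..a + T} F = integral {0..T} F"
proof -
  define M where "M = \<bar>a\<bar> + T + 1"
  obtain A where "\<And>t. t \<in> {-M..M} \<Longrightarrow> (A has_vector_derivative F t) (at t within {-M..M})"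
    using antiderivative_continuous[OF continuous_on_subset[OF F(1)], of "-M" M] by blast
  moreover have "at t within {-M..M} = at t" if "t \<in> {-M<..<M}" for t
    using that by (intro at_within_interior) auto
  ultimately have A: "(A has_vector_derivative F t) (at t)" if "t \<in> {-M<..<M}" for t
    using that by (metis greaterThanLessThan_subseteq_atLeastAtMost_iff order_refl subsetD)
  have I: "integral {t..t + T} F = A (t + T) - A t" if "\<bar>t\<bar> \<le> \<bar>a\<bar>" for t
    using that T by (intro integral_unique fundamental_theorem_of_calculus)
      (auto intro!: has_vector_derivative_at_within[OF A] simp: M_def)
  \<comment> \<open>The integral over one period, as a function of its left end point, has
    derivative \<open>F (t + T) - F t = 0\<close>.\<close>
  have "((\<lambda>t. A (t + T) - A t) has_vector_derivative 0) (at t within {-\<bar>a\<bar>..\<bar>a\<bar>})" if "\<bar>t\<bar> \<le> \<bar>a\<bar>" for t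
  proof -
    have "((A \<circ> (\<lambda>t. t + T)) has_vector_derivative 1 *\<^sub>R F (t + T)) (at t)"
      using that T by (intro vector_diff_chain_at A) (auto intro!: derivative_eq_intros simp: M_def)
    moreover have "(A has_vector_derivative F t) (at t)" using that T by (intro A) (auto simp: M_def)
    ultimately have "((\<lambda>t. (A \<circ> (\<lambda>t. t + T)) t - A t) has_vector_derivative 1 *\<^sub>R F (t + T) - F t) (at t)"
      by (rule has_vector_derivative_diff)
    then show ?thesis using F(2) by (auto simp: o_def intro: has_vector_derivative_at_within)
  qed
  then obtain k where k: "\<And>t. t \<in> {-\<bar>a\<bar>..\<bar>a\<bar>} \<Longrightarrow> A (t + T) - A t = k"
    by (rule has_vector_derivative_zero_constant[of "{-\<bar>a\<bar>..\<bar>a\<bar>}", rotated]) auto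
  then show ?thesis using I[of a] I[of 0] k[of a] k[of 0] by (cases "a \<ge> 0") auto
qed

text \<open>Let \<open>X z\<close> be the solution of the clipped equation with initial value \<open>z\<close>.  Antiperiodicity
\<open>X z \<pi> = - z\<close> says that \<open>z\<close> is a fixed point of \<open>G z = (z - X z \<pi>) / 2\<close>.  Brouwer's theorem gives
a fixed point \<open>z\<close> of \<open>G\<close> followed by the radial retraction onto the unit disc.  If \<open>G z\<close> were outside the
disc, then \<open>|z| = 1\<close> and \<open>G z = m z\<close> with \<open>m > 1\<close>, that is \<open>X z \<pi> = - (2 m - 1) z\<close>: a crossing that is
too short.  So \<open>X z\<close> extends to an antiperiodic solution that starts in the closed disc.  It never
has modulus \<open>1\<close>, again because it would then cross from a unit vector to its negative, so by continuity
it stays inside the disc, where the clipped equation is the true one.\<close>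

lemma closed_orbit:
  fixes F :: "real \<Rightarrow> real"
  assumes F: "continuous_on UNIV F" "\<And>t. F t > 0" "\<And>t. F (t + pi) = F t"
    and mass: "integral {0..pi} F < 1.28"
  obtains x :: "real \<Rightarrow> complex" where "\<And>t. x (t + pi) = - x t" and "\<And>t. cmod (x t) < 1"
    and "\<And>t. (x has_vector_derivative \<i> * cis t * of_real (F t * exp ((cmod (x t))\<^sup>2 / 2))) (at t)"
proof -
  define V where "V t z = \<i> * cis t * of_real (F t * clipped_weight z)" for t z
  have V_norm: "cmod (V t z) = F t * clipped_weight z" for t z
    using F(2)[of t] clipped_weight_pos[of z] by (simp add: V_def norm_mult)
  have cw_cont: "continuous_on S clipped_weight" for S
    unfolding clipped_weight_def by (intro continuous_intros) auto
  have "bounded (F ` {0..pi})"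
    by (intro compact_imp_bounded compact_continuous_image continuous_on_subset[OF F(1)]) auto
  then obtain B where "\<forall>y\<in>F ` {0..pi}. norm y \<le> B" unfolding bounded_iff by blast
  then have B: "F t \<le> B" if "t \<in> {0..pi}" for t using that by force
  obtain X where X0: "\<And>z. X z 0 = z"
    and XD: "\<And>z t. t \<in> {0..pi} \<Longrightarrow> (X z has_vector_derivative V t (X z t)) (at t within {0..pi})"
    and Xc: "\<And>t. t \<in> {0..pi} \<Longrightarrow> continuous_on UNIV (\<lambda>z. X z t)"
  proof (rule picard_flow[of pi V "B * exp 1"])
    have "continuous_on ({0..pi} \<times> UNIV) (\<lambda>p. F (fst p))"
      by (rule continuous_on_compose2[OF F(1)]) (auto intro: continuous_intros)
    moreover have "continuous_on ({0..pi} \<times> UNIV) (\<lambda>p::real \<times> complex. clipped_weight (snd p))"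
      by (rule continuous_on_compose2[OF cw_cont[of UNIV]]) (auto intro: continuous_intros)
    ultimately show "continuous_on ({0..pi} \<times> UNIV) (\<lambda>(t, z). V t z)"
      unfolding V_def case_prod_beta cis_conv_exp by (intro continuous_intros) auto
    fix t z w assume t: "t \<in> {0..pi}"
    have "V t z - V t w = \<i> * cis t * of_real (F t * (clipped_weight z - clipped_weight w))"
      by (simp add: V_def algebra_simps)
    then have "norm (V t z - V t w) = F t * \<bar>clipped_weight z - clipped_weight w\<bar>"
      using F(2)[of t] by (simp add: norm_mult abs_mult flip: of_real_diff)
    also have "\<dots> \<le> B * (exp 1 * cmod (z - w))"
      using B[OF t] F(2)[of t] by (intro mult_mono clipped_weight_lipschitz) auto
    finally show "norm (V t z - V t w) \<le> B * exp 1 * norm (z - w)" by simp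
  qed auto
  define G where "G z = (z - X z pi) / 2" for z
  have G_cont: "continuous_on UNIV G" unfolding G_def by (intro continuous_intros Xc) auto
  define r :: "complex \<Rightarrow> complex" where "r z = z / of_real (max 1 (cmod z))" for z
  have "max 1 (cmod w) \<noteq> 0" for w by linarith
  then have "continuous_on (cball 0 1) (\<lambda>z. r (G z))"
    unfolding r_def
    by (intro continuous_intros continuous_on_subset[OF G_cont]) (auto simp only: of_real_eq_0_iff)
  moreover have "(\<lambda>z. r (G z)) \<in> cball 0 1 \<rightarrow> cball 0 1"
    by (auto simp: r_def norm_divide divide_le_eq)
  ultimately obtain z where z: "z \<in> cball 0 1" "r (G z) = z"
    using brouwer_ball[of 1 "0::complex" "\<lambda>z. r (G z)"] by auto
  have speed: "cmod (V t (u t)) \<le> F t * clipped_weight (u t)" for t u by (simp add: V_norm)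
  have Gz: "cmod (G z) \<le> 1"
  proof (rule ccontr)
    assume "\<not> cmod (G z) \<le> 1"
    define m where "m = cmod (G z)"
    have m: "m > 1" using \<open>\<not> cmod (G z) \<le> 1\<close> by (simp add: m_def)
    have "G z / of_real m = z" using z(2) m by (simp add: r_def m_def max_def split: if_splits)
    then have Gm: "G z = of_real m * z" using m by (auto simp: field_simps)
    then have "m = m * cmod z" using m by (metis abs_of_pos less_trans m_def norm_mult norm_of_real zero_less_one)
    then have z1: "cmod z = 1" using m by simp
    have "X z pi = - ((2 * m - 1) *\<^sub>R X z 0)"
      using Gm by (simp add: G_def X0 scaleR_conv_of_real field_simps)
    then show False
      using no_short_crossing[of 0 pi "X z" "\<lambda>t. V t (X z t)" F "2 * m - 1"] XD mass m speed z1
        continuous_on_subset[OF F(1)] by (auto simp: X0)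
  qed
  then have "G z = z" using z(2) by (simp add: r_def max_def split: if_splits)
  then have per: "X z pi = - X z 0" by (simp add: G_def X0 field_simps add_eq_0_iff)
  have "V (t + pi) (- w) = - V t w" for t w
    by (simp add: V_def clipped_weight_def F(3) flip: cis_mult)
  then obtain x where x: "\<And>t. (x has_vector_derivative V t (x t)) (at t)"
    "\<And>t. x (t + pi) = - x t" "x 0 = X z 0"
    using antiperiodic_extension[of pi "X z" V] XD per by (metis pi_gt_zero)
  have x_cont: "continuous_on UNIV (\<lambda>t. cmod (x t))"
    using x(1) by (intro continuous_intros) (meson continuous_at_imp_continuous_on has_vector_derivative_continuous)
  have no1: "cmod (x t) \<noteq> 1" for t
  proof
    assume t: "cmod (x t) = 1"
    show False
    proof (rule no_short_crossing[of t "t + pi" x "\<lambda>t. V t (x t)" F 1])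
      show "integral {t..t + pi} F < 1.28"
        using mass integral_periodic[OF F(1,3), of t] by simp
    qed (use t x speed F(1) in \<open>auto intro: has_vector_derivative_at_within continuous_on_subset\<close>)
  qed
  have lt1: "cmod (x t) < 1" for t
  proof (rule ccontr)
    assume "\<not> cmod (x t) < 1"
    moreover have "cmod (x 0) \<le> 1" using z(1) by (simp add: x(3) X0)
    moreover have "connected (range (\<lambda>t. cmod (x t)))"
      by (rule connected_continuous_image[OF x_cont connected_UNIV])
    ultimately have "1 \<in> range (\<lambda>t. cmod (x t))"
      using connectedD_interval[of "range (\<lambda>t. cmod (x t))" "cmod (x 0)" "cmod (x t)" 1] by simp
    then show False using no1 by auto
  qed
  show thesis
  proof (rule that[of x, OF x(2) lt1])
    show "(x has_vector_derivative \<i> * cis t * of_real (F t * exp ((cmod (x t))\<^sup>2 / 2))) (at t)" for t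
      using x(1)[of t] lt1[of t] by (simp add: V_def clipped_weight_def min_def)
  qed
qed

section \<open>The convex body with a given even support function\<close>

lemma circle_point_nth [simp]: "circle_point s $ 1 = cos s" "circle_point s $ 2 = sin s"
  by (simp_all add: circle_point_def)

lemma circle_point_inner: "y \<bullet> circle_point s = y $ 1 * cos s + y $ 2 * sin s"
  by (simp add: inner_vec_def sum_2)

lemma norm_circle_point [simp]: "norm (circle_point s) = 1"
  by (simp add: norm_eq_sqrt_inner inner_vec_def sum_2 flip: power2_eq_square)

lemma circle_point_inner_circle_point: "circle_point t \<bullet> circle_point s = cos (t - s)"
  by (simp add: circle_point_inner cos_diff)

lemma circle_point_add_pi: "circle_point (s + pi) = - circle_point s"
  by (simp add: vec_eq_iff forall_2)

lemma continuous_on_circle_point [continuous_intros]: "continuous_on A circle_point"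
proof -
  have eq: "circle_point = (\<lambda>s. cos s *\<^sub>R axis 1 1 + sin s *\<^sub>R axis 2 1)"
    by (rule ext) (simp add: vec_eq_iff forall_2 axis_def)
  show ?thesis unfolding eq by (intro continuous_intros)
qed

lemma polar_decomposition:
  obtains s where "y = norm y *\<^sub>R circle_point s"
proof (cases "y = 0")
  case False
  have n: "(y $ 1)\<^sup>2 + (y $ 2)\<^sup>2 = (norm y)\<^sup>2"
    unfolding power2_norm_eq_inner by (simp add: inner_vec_def sum_2 power2_eq_square)
  have "(y $ 1 / norm y)\<^sup>2 + (y $ 2 / norm y)\<^sup>2 = 1"
    unfolding power_divide add_divide_distrib[symmetric] n using False by simp
  then obtain s where "y $ 1 / norm y = cos s" "y $ 2 / norm y = sin s"
    by (rule sincos_total_2pi) blast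
  then have "y $ 1 = norm y * cos s" "y $ 2 = norm y * sin s"
    using False by (metis mult.commute nonzero_divide_eq_eq norm_eq_zero)+
  then have "y = norm y *\<^sub>R circle_point s"
    unfolding vec_eq_iff forall_2 vector_scaleR_component circle_point_nth real_scaleR_def by blast
  then show ?thesis by (rule that)
qed (use that in simp)

text \<open>The unit vectors with angles \<open>a\<close> and \<open>a + \<pi>/2\<close>: at the boundary point with outer normal angle \<open>a\<close> they
are the normal and the tangent.\<close>

lemma orthonormal_expansion:
  "y = (y \<bullet> circle_point (a + pi / 2)) *\<^sub>R circle_point (a + pi / 2) + (y \<bullet> circle_point a) *\<^sub>R circle_point a"
proof -
  have sq: "cos a * (cos a * x) + sin a * (sin a * x) = x" for x
    using sin_cos_squared_add[of a] by algebra
  show ?thesis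
    by (simp add: circle_point_inner vec_eq_iff forall_2 sin_add cos_add algebra_simps sq)
qed

text \<open>The Gaussian density is at most \<open>1 / (2 \<pi>)\<close>, and the disc of radius \<open>R\<close> has area \<open>\<pi> R\<^sup>2\<close>.\<close>

lemma gaussian_measure_small_ball:
  assumes "K \<subseteq> cball 0 R" "0 \<le> R" "R < 1"
  shows "measure gaussian_plane K < 1 / 2"
proof (cases "K \<in> sets lborel")
  case True
  have "emeasure gaussian_plane K = (\<integral>\<^sup>+ x. ennreal (exp (- (norm x)\<^sup>2 / 2) / (2 * pi)) * indicator K x \<partial>lborel)"
    unfolding gaussian_plane_def using True by (intro emeasure_density) auto
  also have "\<dots> \<le> (\<integral>\<^sup>+ x. ennreal (1 / (2 * pi)) * indicator (cball (0 :: real ^ 2) R) x \<partial>lborel)"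
    using assms(1)
    by (intro nn_integral_mono) (auto simp: indicator_def intro!: ennreal_leI divide_right_mono)
  also have "\<dots> = ennreal (1 / (2 * pi)) * emeasure lborel (cball (0::real^2) R)"
    by (rule nn_integral_cmult_indicator) simp
  also have "\<dots> = ennreal (1 / (2 * pi) * (pi * R\<^sup>2))"
    using assms(2) by (subst emeasure_cball) (simp_all add: unit_ball_vol_2 flip: ennreal_mult')
  finally have "emeasure gaussian_plane K \<le> ennreal (R\<^sup>2 / 2)" by simp
  then have "measure gaussian_plane K \<le> R\<^sup>2 / 2"
    unfolding measure_def by (intro enn2real_leI) auto
  also have "R\<^sup>2 < 1" using assms by (simp add: abs_square_less_1)
  finally show ?thesis by simp
next
  case False
  then show ?thesis by (simp add: gaussian_plane_def measure_notin_sets)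
qed

text \<open>The function \<open>h\<close> is going to be the support function of a convex body, \<open>k\<close> is its derivative and
\<open>g = h'' + h\<close> the radius of curvature of the boundary.  Period \<open>\<pi>\<close> is the symmetry of the body.\<close>

locale even_support =
  fixes h k g :: "real \<Rightarrow> real"
  assumes h_deriv: "\<And>t. (h has_real_derivative k t) (at t)"
    and k_deriv: "\<And>t. (k has_real_derivative g t - h t) (at t)"
    and g_pos: "\<And>t. g t > 0"
    and h_even: "\<And>t. h (t + pi) = h t"
begin

text \<open>The boundary point at which the outer normal has angle \<open>t\<close>.\<close>

definition curve :: "real \<Rightarrow> real ^ 2" where
  "curve t = h t *\<^sub>R circle_point t + k t *\<^sub>R circle_point (t + pi / 2)"

definition body :: "(real ^ 2) set" where
  "body = {y. \<forall>s. y \<bullet> circle_point s \<le> h s}"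

lemma k_even: "k (t + pi) = k t"
proof -
  have "((\<lambda>t. h (t + pi)) has_real_derivative k (t + pi)) (at t)"
    using h_deriv[of "t + pi"] by (simp add: DERIV_shift)
  then show ?thesis using h_deriv[of t] DERIV_unique by (simp add: h_even)
qed

lemma h_cont: "continuous_on A h" and k_cont: "continuous_on A k"
  using h_deriv k_deriv by (meson DERIV_continuous continuous_at_imp_continuous_on)+

lemma curve_inner: "curve t \<bullet> circle_point s = h t * cos (t - s) - k t * sin (t - s)"
proof -
  have "cos (t + pi / 2 - s) = - sin (t - s)"
    using cos_add[of "t - s" "pi / 2"] by (simp add: algebra_simps)
  then show ?thesis by (simp add: curve_def inner_add_left circle_point_inner_circle_point)
qed

lemma curve_inner_self [simp]: "curve t \<bullet> circle_point t = h t"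
  by (simp add: curve_inner)

text \<open>Equivalently, the curve moves along its tangent with speed \<open>g\<close>.  All of the convex geometry below comes
from the sign of this derivative.\<close>

lemma curve_inner_deriv:
  "((\<lambda>t. curve t \<bullet> circle_point s) has_real_derivative - g t * sin (t - s)) (at t)"
  unfolding curve_inner
  by (auto intro!: derivative_eq_intros h_deriv k_deriv simp: algebra_simps)

lemma curve_add_pi: "curve (t + pi) = - curve t"
proof -
  have "t + pi + pi / 2 = t + pi / 2 + pi" by simp
  then show ?thesis
    by (simp only: curve_def h_even k_even circle_point_add_pi scaleR_minus_right minus_add_distrib)
qed

lemma curve_periodic: "curve (t + of_int n * (2 * pi)) = curve t"
proof -
  have *: "curve (t + 2 * pi) = curve t" for t
    using curve_add_pi[of "t + pi"] curve_add_pi[of t] by (simp add: add.assoc)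
  show ?thesis
  proof (induction n rule: int_induct[of _ 0])
    case (step1 i)
    then show ?case using *[of "t + of_int i * (2 * pi)"] by (simp add: algebra_simps)
  next
    case (step2 i)
    then show ?case using *[of "t + of_int (i - 1) * (2 * pi)"] by (simp add: algebra_simps)
  qed simp
qed

lemma curve_representative:
  obtains t' where "s \<le> t'" "t' < s + 2 * pi" "curve t' = curve t"
proof -
  define n where "n = - \<lfloor>(t - s) / (2 * pi)\<rfloor>"
  have "s \<le> t + of_int n * (2 * pi)" "t + of_int n * (2 * pi) < s + 2 * pi"
    using floor_divide_lower[of "2 * pi" "t - s"] floor_divide_upper[of "2 * pi" "t - s"]
    by (auto simp: n_def algebra_simps)
  then show ?thesis using curve_periodic[of t n] that by blast
qed

lemma curve_cont: "continuous_on A curve"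
proof -
  have "continuous_on A (\<lambda>t. circle_point (t + pi / 2))"
    by (rule continuous_on_compose2[OF continuous_on_circle_point[of UNIV]]) (auto intro: continuous_intros)
  then show ?thesis unfolding curve_def by (intro continuous_intros h_cont k_cont)
qed

text \<open>The boundary point with normal angle \<open>s\<close> is the only one that maximizes the inner product with that
normal: the product decreases on the half turn after \<open>s\<close> and increases on the next one.\<close>

lemma curve_inner_less:
  assumes "s < t" "t < s + 2 * pi"
  shows "curve t \<bullet> circle_point s < h s"
proof (cases "t \<le> s + pi")
  case True
  have "curve t \<bullet> circle_point s < curve s \<bullet> circle_point s"
  proof (rule DERIV_neg_imp_decreasing_open[OF assms(1)])
    fix v assume v: "s < v" "v < t"
    then have "sin (v - s) > 0" using True by (intro sin_gt_zero) auto
    then show "\<exists>d. ((\<lambda>t. curve t \<bullet> circle_point s) has_real_derivative d) (at v) \<and> d < 0"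
      using curve_inner_deriv[of s v] g_pos[of v] by (intro exI[of _ "- g v * sin (v - s)"]) auto
  qed (intro continuous_intros curve_cont)
  then show ?thesis by simp
next
  case False
  have "curve t \<bullet> circle_point s < curve (s + 2 * pi) \<bullet> circle_point s"
  proof (rule DERIV_pos_imp_increasing_open[OF assms(2)])
    fix v assume v: "t < v" "v < s + 2 * pi"
    then have "sin (v - s) < 0" using False by (intro sin_lt_zero) auto
    then show "\<exists>d. ((\<lambda>t. curve t \<bullet> circle_point s) has_real_derivative d) (at v) \<and> d > 0"
      using curve_inner_deriv[of s v] g_pos[of v]
      by (intro exI[of _ "- g v * sin (v - s)"]) (auto simp: mult_pos_neg)
  qed (intro continuous_intros curve_cont)
  then show ?thesis using curve_periodic[of s 1] by simp
qed

text \<open>By symmetry the value at the antipode of the maximizer is \<open>- h s\<close>, and it is not maximal.\<close>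

lemma h_pos: "h s > 0"
  using curve_inner_less[of s "s + pi"] by (simp add: curve_add_pi)

lemma curve_in_body: "curve t \<in> body"
  unfolding body_def
proof safe
  fix s
  obtain t' where t': "s \<le> t'" "t' < s + 2 * pi" "curve t' = curve t" by (rule curve_representative)
  then show "curve t \<bullet> circle_point s \<le> h s"
    using curve_inner_less[of s t'] curve_inner_self[of s] by (cases "t' = s") auto
qed

lemma body_closed: "closed body"
  unfolding body_def by (intro closed_Collect_all closed_Collect_le continuous_intros)

lemma body_convex: "convex body"
proof -
  have "body = (\<Inter>s. {y. circle_point s \<bullet> y \<le> h s})" by (auto simp: body_def inner_commute)
  then show ?thesis by (auto intro: convex_INT convex_halfspace_le)
qed

lemma body_subset_cball:
  assumes "\<And>t. h t \<le> R" shows "body \<subseteq> cball 0 R"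
proof
  fix y assume y: "y \<in> body"
  obtain s where s: "y = norm y *\<^sub>R circle_point s" by (rule polar_decomposition)
  have "y \<bullet> circle_point s = norm y"
    by (subst s) (simp add: circle_point_inner_circle_point)
  then have "norm y \<le> h s" using y by (auto simp: body_def dest: spec[of _ s])
  then show "y \<in> cball 0 R" using assms[of s] by simp
qed

lemma support_function_body: "of_angle (support_function body) = h"
proof
  fix s
  have "support_function body (circle_point s) = h s"
    unfolding support_function_def
  proof (rule cSup_eq_maximum)
    show "h s \<in> (\<lambda>x. x \<bullet> circle_point s) ` body"
      using curve_in_body[of s] by (intro image_eqI[of _ _ "curve s"]) auto
  qed (auto simp: body_def)
  then show "of_angle (support_function body) s = h s" by (simp add: of_angle_def)
qed

lemma body_symmetric: "origin_symmetric body"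
proof -
  have "- y \<in> body" if "y \<in> body" for y
  proof -
    have "y \<bullet> circle_point (s + pi) \<le> h (s + pi)" for s using that by (auto simp: body_def)
    then show ?thesis by (auto simp: body_def circle_point_add_pi h_even)
  qed
  then show ?thesis unfolding origin_symmetric_def by (force intro: image_eqI[of _ uminus "- y" for y])
qed

text \<open>By compactness of the circle the slack in the defining inequalities has a positive minimum \<open>d\<close>, and then
the ball of radius \<open>d\<close> around \<open>y\<close> satisfies all of them.\<close>

lemma body_interiorI:
  assumes "\<And>s. y \<bullet> circle_point s < h s"
  shows "y \<in> interior body"
proof -
  have "continuous_on {0..2 * pi} (\<lambda>s. h s - y \<bullet> circle_point s)" by (intro continuous_intros h_cont)
  then obtain s0 where s0: "\<And>s. s \<in> {0..2 * pi} \<Longrightarrow> h s0 - y \<bullet> circle_point s0 \<le> h s - y \<bullet> circle_point s"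
    using continuous_attains_inf[of "{0..2 * pi}" "\<lambda>s. h s - y \<bullet> circle_point s"] by force
  define d where "d = h s0 - y \<bullet> circle_point s0"
  have d: "d > 0" using assms by (simp add: d_def)
  have dle: "y \<bullet> circle_point s + d \<le> h s" for s
  proof -
    define s' where "s' = s + of_int (- \<lfloor>s / (2 * pi)\<rfloor>) * (2 * pi)"
    have s': "s' \<in> {0..2 * pi}"
      using floor_divide_lower[of "2 * pi" s] floor_divide_upper[of "2 * pi" s]
      by (auto simp: s'_def algebra_simps)
    have "curve s' = curve s" unfolding s'_def by (rule curve_periodic)
    moreover have "circle_point s' = circle_point s"
      unfolding s'_def vec_eq_iff forall_2 by (simp add: cos_diff sin_diff mult.commute[of _ "2 * pi"])
    ultimately have "h s' = h s" by (metis curve_inner_self)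
    then show ?thesis using s0[OF s'] \<open>circle_point s' = circle_point s\<close> by (simp add: d_def)
  qed
  have "ball y d \<subseteq> body"
  proof
    fix z assume z: "z \<in> ball y d"
    have "z \<bullet> circle_point s \<le> h s" for s
    proof -
      have "(z - y) \<bullet> circle_point s \<le> norm (z - y) * norm (circle_point s)" by (rule norm_cauchy_schwarz)
      also have "\<dots> \<le> d" using z by (simp add: dist_norm norm_minus_commute)
      finally show ?thesis using dle[of s] by (simp add: inner_diff_left)
    qed
    then show "z \<in> body" by (simp add: body_def)
  qed
  then show ?thesis using d by (meson centre_in_ball interior_maximal open_ball subsetD)
qed

lemma body_is_convex_body: "convex_body body"
proof -
  have "0 \<in> interior body" by (rule body_interiorI) (simp add: h_pos)
  moreover have "bounded body"
  proof -
    have "bounded (range h)"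
      by (rule bounded_range_if_periodic[of pi]) (auto simp: h_even intro: h_cont)
    then obtain R where "\<forall>y\<in>range h. norm y \<le> R" unfolding bounded_iff by blast
    then have "body \<subseteq> cball 0 R" by (intro body_subset_cball) (force simp: abs_le_iff)
    then show ?thesis by (rule bounded_subset[OF bounded_cball])
  qed
  ultimately show ?thesis
    unfolding convex_body_def compact_eq_bounded_closed using body_closed body_convex by auto
qed

text \<open>At a frontier point \<open>y\<close> the slack \<open>h t - y \<bullet> circle_point t\<close>, which is nonnegative, vanishes for some \<open>s\<close>.
It has a minimum there, so its derivative vanishes as well.  The two equations determine the coordinates of
\<open>y\<close> in the frame at angle \<open>s\<close>, and they are those of \<open>curve s\<close>.\<close>

lemma frontier_body: "frontier body = range curve"
proof (intro equalityI subsetI)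
  fix y assume "y \<in> range curve"
  then obtain t where t: "y = curve t" by auto
  have "y \<notin> interior body"
  proof
    assume "y \<in> interior body"
    then obtain e where e: "e > 0" "cball y e \<subseteq> body" using mem_interior_cball by blast
    have "y + e *\<^sub>R circle_point t \<in> cball y e" using e(1) by (simp add: dist_norm)
    then have "(y + e *\<^sub>R circle_point t) \<bullet> circle_point t \<le> h t" using e(2) by (auto simp: body_def)
    then show False using e(1) by (simp add: t inner_add_left circle_point_inner_circle_point)
  qed
  then show "y \<in> frontier body"
    using curve_in_body[of t] closure_subset[of body] by (auto simp: frontier_def t)
next
  fix y assume y: "y \<in> frontier body"
  then have "y \<in> body" "y \<notin> interior body" using body_closed by (auto simp: frontier_def)
  then obtain s where s: "y \<bullet> circle_point s = h s" and le: "\<And>t. y \<bullet> circle_point t \<le> h t"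
    using body_interiorI[of y] by (force simp: body_def le_less)
  have "((\<lambda>t. h t - (y $ 1 * cos t + y $ 2 * sin t)) has_real_derivative
      k s - (y $ 1 * (- sin s) + y $ 2 * cos s)) (at s)"
    by (auto intro!: derivative_eq_intros h_deriv)
  then have "k s - (y $ 1 * (- sin s) + y $ 2 * cos s) = 0"
    by (rule DERIV_local_min[of _ _ _ 1]) (use s le in \<open>auto simp: circle_point_inner\<close>)
  then have "y \<bullet> circle_point (s + pi / 2) = k s"
    by (simp add: circle_point_inner cos_add sin_add)
  then have "y = curve s"
    using orthonormal_expansion[of y s] s by (simp add: curve_def add.commute)
  then show "y \<in> range curve" by simp
qed

text \<open>In the tangent-normal frame at the point with normal angle \<open>a\<close>, the curve is \<open>(S t, C t)\<close> with
\<open>S' = g cos (t - a)\<close> and \<open>C' = - g sin (t - a)\<close>.  For normal angles within \<open>\<pi>/4\<close> of \<open>a\<close> the coordinate \<open>S\<close> is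
strictly increasing, with inverse \<open>\<tau>\<close>, \<open>\<tau>' = P(\<tau>)\<close>, \<open>P = 1 / (g cos (t - a))\<close>, and the boundary is the graph of
\<open>G = C \<circ> \<tau>\<close>.  The factor \<open>g\<close> cancels in the slope \<open>G' = - tan (\<tau> - a)\<close>, so \<open>G'' = - P(\<tau>) / cos\<^sup>2 (\<tau> - a)\<close> is as
regular as \<open>g\<close> itself: two orders are gained.\<close>

lemma body_boundary_holder:
  assumes \<alpha>: "0 < \<alpha>" "\<alpha> < 1" and g: "bounded_holder 2 \<alpha> UNIV g"
  shows "C_holder_boundary 4 \<alpha> body"
  unfolding C_holder_boundary_def
proof
  fix p assume "p \<in> frontier body"
  then obtain a where p: "p = curve a" by (auto simp: frontier_body)
  define e n where "e = circle_point (a + pi / 2)" and "n = circle_point a"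
  define J where "J = {a - pi / 4<..<a + pi / 4}"
  define S where "S t = curve t \<bullet> e - p \<bullet> e" for t
  define C where "C t = curve t \<bullet> n - p \<bullet> n" for t
  have expand: "curve t = p + S t *\<^sub>R e + C t *\<^sub>R n" for t
    using orthonormal_expansion[of "curve t - p" a]
    by (simp add: S_def C_def e_def n_def inner_diff_left algebra_simps)
  have sin_shift: "sin (t - (a + pi / 2)) = - cos (t - a)" for t
    using sin_diff[of "t - a" "pi / 2"] by (simp add: algebra_simps)
  have S_deriv: "(S has_real_derivative g t * cos (t - a)) (at t)" for t
    using DERIV_diff[OF curve_inner_deriv[of "a + pi / 2" t] DERIV_const[of "p \<bullet> e"]]
    by (simp add: S_def[abs_def] e_def sin_shift)
  have C_deriv: "(C has_real_derivative - g t * sin (t - a)) (at t)" for t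
    using DERIV_diff[OF curve_inner_deriv[of a t] DERIV_const[of "p \<bullet> n"]]
    by (simp add: C_def[abs_def] n_def)
  have S_cont: "continuous_on A S" and C_cont: "continuous_on A C" for A
    unfolding S_def C_def by (intro continuous_intros curve_cont)+
  have cos_ge: "cos (t - a) \<ge> cos (pi / 4)" if "t \<in> {a - pi / 4..a + pi / 4}" for t
  proof -
    have "\<bar>t - a\<bar> \<le> pi / 4" unfolding abs_le_iff using that by auto
    then have "cos (pi / 4) \<le> cos \<bar>t - a\<bar>" by (intro cos_monotone_0_pi_le) auto
    then show ?thesis by simp
  qed
  have c4: "cos (pi / 4) > (0::real)" by (intro cos_gt_zero) auto
  have S_mono: "S t < S t'" if "t < t'" "a - pi / 4 \<le> t" "t' \<le> a + pi / 4" for t t'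
  proof (rule DERIV_pos_imp_increasing_open[OF that(1)])
    fix v assume "t < v" "v < t'"
    then have "cos (v - a) > 0" using that c4 cos_ge[of v] by auto
    then show "\<exists>d. (S has_real_derivative d) (at v) \<and> d > 0" using S_deriv[of v] g_pos[of v] by auto
  qed (rule S_cont)
  have Sa: "S a = 0" by (simp add: S_def p)
  define r where "r = min (- S (a - pi / 4)) (S (a + pi / 4))"
  have r: "r > 0" using S_mono[of "a - pi / 4" a] S_mono[of a "a + pi / 4"] Sa by (simp add: r_def)
  have "\<exists>t\<in>J. S t = s" if s: "s \<in> {-r<..<r}" for s
  proof -
    have "S (a - pi / 4) < s" "s < S (a + pi / 4)" using s by (auto simp: r_def)
    moreover from this obtain t where "a - pi / 4 \<le> t" "t \<le> a + pi / 4" "S t = s"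
      using IVT'[of S "a - pi / 4" s "a + pi / 4"] S_cont by (auto simp: less_imp_le)
    ultimately show ?thesis by (intro bexI[of _ t]) (auto simp: J_def less_le)
  qed
  then obtain \<tau> where \<tau>: "\<And>s. s \<in> {-r<..<r} \<Longrightarrow> \<tau> s \<in> J" "\<And>s. s \<in> {-r<..<r} \<Longrightarrow> S (\<tau> s) = s"
    by metis
  have \<tau>S: "\<tau> (S t) = t" if "t \<in> J" "S t \<in> {-r<..<r}" for t
    using S_mono[of t "\<tau> (S t)"] S_mono[of "\<tau> (S t)" t] \<tau>[OF that(2)] that(1)
    by (cases t "\<tau> (S t)" rule: linorder_cases) (auto simp: J_def)
  define P where "P t = inverse (g t * cos (t - a))" for t
  have \<tau>_deriv: "(\<tau> has_real_derivative P (\<tau> s)) (at s)" if s: "s \<in> {-r<..<r}" for s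
  proof -
    define W where "W = J \<inter> S -` {-r<..<r}"
    have "open W" unfolding W_def J_def by (intro continuous_open_preimage S_cont) auto
    moreover have "\<tau> s \<in> W" using \<tau>[OF s] s by (simp add: W_def)
    moreover define d where "d = g (\<tau> s) * cos (\<tau> s - a)"
    then have "d \<noteq> 0"
      using cos_ge[of "\<tau> s"] c4 \<tau>(1)[OF s] g_pos[of "\<tau> s"] by (auto simp: J_def)
    moreover have "(S has_derivative (*) d) (at (\<tau> s))"
      using S_deriv[of "\<tau> s"] by (simp add: d_def has_field_derivative_def)
    ultimately have "(\<tau> has_derivative (*) (inverse d)) (at (S (\<tau> s)))"
      by (intro has_derivative_inverse_strong[of W _ S]) (auto simp: W_def \<tau>S S_cont fun_eq_iff)
    then show ?thesis by (simp add: \<tau>(2)[OF s] P_def d_def has_field_derivative_def)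
  qed
  define G where "G s = C (\<tau> s)" for s
  have J: "convex J" "open J" "J \<subseteq> {a - pi / 4..a + pi / 4}" by (auto simp: J_def)
  have \<tau>J: "\<tau> ` {-r<..<r} \<subseteq> J" using \<tau>(1) by auto
  have \<alpha>': "0 \<le> \<alpha>" "\<alpha> \<le> 1" using \<alpha> by auto
  have "C_holder_on {-r<..<r} 4 \<alpha> G"
  proof -
    have g_cont: "continuous_on UNIV g"
      using bounded_holder_imp_C_holder_on[OF \<alpha>(1) open_UNIV, of 0 g]
        bounded_holder_mono[OF convex_UNIV \<alpha>' g, of 0] by (simp add: C_holder_on_def)
    obtain t0 where t0: "\<And>t. t \<in> {a - pi / 4..a + pi / 4} \<Longrightarrow> g t0 \<le> g t"
      using continuous_attains_inf[of "{a - pi / 4..a + pi / 4}" g] continuous_on_subset[OF g_cont] by force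
    have gJ: "bounded_holder 2 \<alpha> J g" by (rule bounded_holder_subset[OF g]) simp
    have sec: "bounded_holder 2 \<alpha> J (\<lambda>t. inverse (cos (t - a)))"
      using cos_ge J(3) by (intro bounded_holder_inverse[OF J(1) \<alpha>' _ c4] bounded_holder_cos_sin J(1) \<alpha>') auto
    have Pb: "bounded_holder 2 \<alpha> J P"
      unfolding P_def
    proof (rule bounded_holder_inverse[OF J(1) \<alpha>'])
      show "bounded_holder 2 \<alpha> J (\<lambda>t. g t * cos (t - a))" by (intro bounded_holder_mult bounded_holder_cos_sin gJ J(1) \<alpha>')
      show "g t0 * cos (pi / 4) > 0" using g_pos c4 by simp
      show "g t0 * cos (pi / 4) \<le> g t * cos (t - a)" if "t \<in> J" for t
        using t0[of t] cos_ge[of t] that J(3) g_pos c4 by (intro mult_mono) (auto intro: less_imp_le)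
    qed
    define sec2 where "sec2 t = - 1 * (inverse (cos (t - a)) * inverse (cos (t - a)))" for t
    have "bounded_holder 2 \<alpha> J (\<lambda>t. sec2 t * P t)"
      unfolding sec2_def by (intro bounded_holder_mult bounded_holder_const sec Pb J(1) \<alpha>')
    then have G2: "bounded_holder 2 \<alpha> {-r<..<r} (\<lambda>s. sec2 (\<tau> s) * P (\<tau> s))"
      using bounded_holder_flow[of "{-r<..<r}" \<alpha> J \<tau> P 2 "\<lambda>t. sec2 t * P t"] \<alpha>' J(1) \<tau>J \<tau>_deriv Pb by simp
    define G' where "G' s = - sin (\<tau> s - a) * inverse (cos (\<tau> s - a))" for s
    have cos_pos: "cos (\<tau> s - a) > 0" if "s \<in> {-r<..<r}" for s
      using cos_ge[of "\<tau> s"] c4 \<tau>(1)[OF that] by (auto simp: J_def)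
    have G'_deriv: "(G' has_real_derivative sec2 (\<tau> s) * P (\<tau> s)) (at s)" if s: "s \<in> {-r<..<r}" for s
    proof -
      have "w * (cos v * cos v) + w * (sin v * sin v) = w" for v w :: real
        using sin_cos_squared_add3[of v] by (simp flip: distrib_left)
      then show ?thesis
        unfolding G'_def sec2_def using cos_pos[OF s]
        by (auto intro!: derivative_eq_intros \<tau>_deriv[OF s] simp: field_simps)
    qed
    have G_deriv: "(G has_real_derivative G' s) (at s)" if s: "s \<in> {-r<..<r}" for s
    proof -
      have "(G has_real_derivative (- g (\<tau> s) * sin (\<tau> s - a)) * P (\<tau> s)) (at s)"
        unfolding G_def[abs_def] by (rule DERIV_chain2[OF C_deriv \<tau>_deriv[OF s]])
      then show ?thesis using g_pos[of "\<tau> s"] cos_pos[OF s] by (simp add: P_def G'_def field_simps)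
    qed
    have "bounded (G' ` {-r<..<r})"
    proof -
      have "bounded_holder 2 \<alpha> J (\<lambda>t. - 1 * (sin (t - a) * inverse (cos (t - a))))"
        by (intro bounded_holder_mult bounded_holder_const bounded_holder_cos_sin sec J(1) \<alpha>')
      then have "bounded ((\<lambda>t. - 1 * (sin (t - a) * inverse (cos (t - a)))) ` J)"
        by (rule bounded_holder_bounded)
      then show ?thesis by (rule bounded_subset) (use \<tau>J in \<open>auto simp: G'_def\<close>)
    qed
    moreover have "bounded (G ` {-r<..<r})"
    proof -
      have "bounded (C ` {a - pi / 4..a + pi / 4})"
        by (intro compact_imp_bounded compact_continuous_image C_cont) auto
      then show ?thesis by (rule bounded_subset) (use \<tau>J J(3) in \<open>auto simp: G_def\<close>)
    qed
    ultimately have "bounded_holder (Suc (Suc 2)) \<alpha> {-r<..<r} G"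
      by (intro bounded_holder_SucI[OF _ G_deriv] bounded_holder_SucI[OF _ G'_deriv] G2)
    moreover have "Suc (Suc 2) = (4 :: nat)" by simp
    ultimately have "bounded_holder 4 \<alpha> {-r<..<r} G" by metis
    then show ?thesis by (rule bounded_holder_imp_C_holder_on[OF \<alpha>(1) open_greaterThanLessThan])
  qed
  moreover
  define far where "far = curve ` {a + pi / 4..a + 2 * pi - pi / 4}"
  \<comment> \<open>Removing the compact arc \<open>far\<close> of all other boundary points
    leaves an open set in which only the graph is visible.\<close>
  define U where "U = {y. \<bar>y \<bullet> e - p \<bullet> e\<bar> < r} - far"
  have far: "curve t \<notin> far" if t: "t \<in> J" for t
  proof
    assume "curve t \<in> far"
    then obtain t' where "a + pi / 4 \<le> t'" "t' \<le> a + 2 * pi - pi / 4" "curve t' = curve t"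
      by (auto simp: far_def)
    then show False using curve_inner_less[of t t'] t by (simp add: J_def)
  qed
  have "closed far"
    unfolding far_def by (intro compact_imp_closed compact_continuous_image curve_cont) auto
  then have "open U"
    unfolding U_def by (intro open_Diff open_Collect_less continuous_intros)
  moreover have "p \<in> U" using far[of a] r by (simp add: U_def p J_def)
  moreover have "frontier body \<inter> U = (\<lambda>s. p + s *\<^sub>R e + G s *\<^sub>R n) ` {-r<..<r}"
  proof (intro equalityI subsetI)
    fix y assume y: "y \<in> frontier body \<inter> U"
    then obtain t0 where "y = curve t0" by (auto simp: frontier_body)
    then obtain t where t: "a - pi / 4 \<le> t" "t < a - pi / 4 + 2 * pi" "y = curve t"
      using curve_representative[of "a - pi / 4" t0] by metis
    have "t < a + pi / 4" using t y by (force simp: U_def far_def)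
    moreover have "t \<noteq> a - pi / 4"
    proof
      assume "t = a - pi / 4"
      then have "a + 2 * pi - pi / 4 = t + of_int 1 * (2 * pi)" by simp
      then have "y = curve (a + 2 * pi - pi / 4)" using curve_periodic[of t 1] t(3) by metis
      then show False using y by (auto simp: U_def far_def)
    qed
    ultimately have "t \<in> J" using t by (simp add: J_def)
    moreover have "S t \<in> {-r<..<r}" using y t(3) by (auto simp: U_def S_def)
    ultimately show "y \<in> (\<lambda>s. p + s *\<^sub>R e + G s *\<^sub>R n) ` {-r<..<r}"
      using expand[of t] \<tau>S[of t] t(3) by (intro image_eqI[of _ _ "S t"]) (auto simp: G_def)
  next
    fix y assume "y \<in> (\<lambda>s. p + s *\<^sub>R e + G s *\<^sub>R n) ` {-r<..<r}"
    then obtain s where s: "s \<in> {-r<..<r}" "y = p + s *\<^sub>R e + G s *\<^sub>R n" by auto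
    then have y: "y = curve (\<tau> s)" using expand[of "\<tau> s"] \<tau>(2)[OF s(1)] by (simp add: G_def)
    moreover have "y \<bullet> e - p \<bullet> e = s" using \<tau>(2)[OF s(1)] by (simp add: y S_def)
    ultimately show "y \<in> frontier body \<inter> U"
      using far[OF \<tau>(1)[OF s(1)]] s(1) by (auto simp: frontier_body U_def)
  qed
  moreover have "norm e = 1" "norm n = 1" "e \<bullet> n = 0"
    by (simp_all add: e_def n_def circle_point_inner_circle_point)
  ultimately show "\<exists>U e n r g. open U \<and> p \<in> U \<and> norm e = 1 \<and> norm n = 1 \<and> e \<bullet> n = 0 \<and> r > 0 \<and>
      C_holder_on {-r<..<r} 4 \<alpha> g \<and> frontier body \<inter> U = (\<lambda>s. p + s *\<^sub>R e + g s *\<^sub>R n) ` {-r<..<r}"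
    using r by blast
qed

end

section \<open>From the closed curve to the support function\<close>

text \<open>In the frame that rotates with the normal, a boundary curve in the complex plane with velocity
\<open>i e\<^sup>i\<^sup>t g\<close> has the coordinates \<open>h\<close> and \<open>h'\<close>.\<close>

lemma orbit_even_support:
  fixes x :: "real \<Rightarrow> complex"
  assumes x: "\<And>t. (x has_vector_derivative \<i> * cis t * of_real (g t)) (at t)"
    and anti: "\<And>t. x (t + pi) = - x t" and g: "\<And>t. g t > 0"
  shows "even_support (\<lambda>t. Re (x t * cis (- t))) (\<lambda>t. Im (x t * cis (- t))) g"
proof -
  have cis: "((\<lambda>t. cis (- t)) has_vector_derivative - \<i> * cis (- t)) (at t)" for t
  proof -
    have "((\<lambda>t. Complex (cos t) (- sin t)) has_vector_derivative Complex (- sin t) (- cos t)) (at t)"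
      unfolding has_vector_derivative_complex_iff
      by (auto intro!: derivative_eq_intros simp flip: has_real_derivative_iff_has_vector_derivative)
    moreover have "Complex (cos t) (- sin t) = cis (- t)" "Complex (- sin t) (- cos t) = - \<i> * cis (- t)" for t
      by (simp_all add: complex_eq_iff)
    ultimately show ?thesis by simp
  qed
  have D: "((\<lambda>t. x t * cis (- t)) has_vector_derivative \<i> * of_real (g t) - \<i> * (x t * cis (- t))) (at t)" for t
  proof -
    have "((\<lambda>t. x t * cis (- t)) has_vector_derivative
        x t * (- \<i> * cis (- t)) + \<i> * cis t * of_real (g t) * cis (- t)) (at t)"
      by (rule has_vector_derivative_mult[OF x cis])
    moreover have eq: "\<i> * cis t * of_real (g t) * cis (- t) = \<i> * of_real (g t)"
    proof -
      have "\<i> * cis t * of_real (g t) * cis (- t) = \<i> * of_real (g t) * (cis t * cis (- t))"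
        by (simp only: mult_ac)
      then show ?thesis by (simp add: cis_mult)
    qed
    ultimately show ?thesis unfolding eq by (simp add: algebra_simps)
  qed
  show ?thesis
  proof
    fix t
    show "((\<lambda>t. Re (x t * cis (- t))) has_real_derivative Im (x t * cis (- t))) (at t)"
      using bounded_linear.has_vector_derivative[OF bounded_linear_Re D[of t]]
      by (simp add: has_real_derivative_iff_has_vector_derivative)
    show "((\<lambda>t. Im (x t * cis (- t))) has_real_derivative g t - Re (x t * cis (- t))) (at t)"
      using bounded_linear.has_vector_derivative[OF bounded_linear_Im D[of t]]
      by (simp add: has_real_derivative_iff_has_vector_derivative)
    have "cis (- (t + pi)) = - cis (- t)" by (simp add: complex_eq_iff sin_add cos_add)
    then show "Re (x (t + pi) * cis (- (t + pi))) = Re (x t * cis (- t))" by (simp only: anti) simp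
  qed (rule g)
qed

text \<open>Bootstrapping: \<open>h\<close> and \<open>k\<close> of order \<open>j \<le> m\<close> make \<open>g\<close> and with it \<open>k' = g - h\<close> of order \<open>j\<close>, hence \<open>k\<close> of
order \<open>j + 1\<close>.  It starts because \<open>k'\<close> is bounded, and it stops at the order of \<open>F\<close>.\<close>

lemma support_regularity:
  assumes \<alpha>: "0 \<le> \<alpha>" "\<alpha> \<le> 1" and F: "bounded_holder m \<alpha> UNIV F"
    and h: "\<And>t. (h has_real_derivative k t) (at t)"
    and k: "\<And>t. (k has_real_derivative g t - h t) (at t)"
    and g: "\<And>t. g t = F t * exp (((k t)\<^sup>2 + (h t)\<^sup>2) / 2)"
    and bdd: "bounded (range h)" "bounded (range k)"
  shows "bounded_holder m \<alpha> UNIV g" and "bounded_holder (Suc (Suc m)) \<alpha> UNIV h"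
proof -
  note closure = bounded_holder_add bounded_holder_mult[OF convex_UNIV \<alpha>]
    bounded_holder_exp[OF convex_UNIV \<alpha>] bounded_holder_diff[OF convex_UNIV \<alpha>] bounded_holder_const
  have g_eq: "g = (\<lambda>t. F t * exp (1 / 2 * (k t * k t + h t * h t)))"
    by (rule ext) (simp add: g power2_eq_square)
  have step: "bounded_holder j \<alpha> UNIV g \<and> bounded_holder (Suc j) \<alpha> UNIV k"
    if j: "j \<le> m" "bounded_holder j \<alpha> UNIV k" for j
  proof -
    have "bounded_holder (Suc j) \<alpha> UNIV h" using h j(2) bdd(1) by auto
    then have hj: "bounded_holder j \<alpha> UNIV h" by (rule bounded_holder_Suc_imp[OF convex_UNIV \<alpha>])
    have "bounded_holder j \<alpha> UNIV F" by (rule bounded_holder_mono[OF convex_UNIV \<alpha> F j(1)])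
    then have gj: "bounded_holder j \<alpha> UNIV g" unfolding g_eq by (intro closure j(2) hj)
    then have "bounded_holder j \<alpha> UNIV (\<lambda>t. g t - h t)" by (intro closure hj)
    then show ?thesis using gj k bdd(2) by (auto intro!: exI[of _ "\<lambda>t. g t - h t"])
  qed
  have k0: "bounded_holder 0 \<alpha> UNIV k"
  proof -
    obtain H where H: "\<And>t. \<bar>h t\<bar> \<le> H" using bdd(1) by (auto simp: bounded_image_real)
    obtain M where M: "\<And>t. \<bar>k t\<bar> \<le> M" using bdd(2) by (auto simp: bounded_image_real)
    obtain B where B: "B \<ge> 0" "\<And>t. \<bar>F t\<bar> \<le> B" using bounded_holder_bounded[OF F] by (auto simp: bounded_image_real)
    have "\<bar>g t - h t\<bar> \<le> B * exp ((M\<^sup>2 + H\<^sup>2) / 2) + H" for t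
    proof -
      have "(k t)\<^sup>2 \<le> M\<^sup>2" "(h t)\<^sup>2 \<le> H\<^sup>2"
        using power_mono[OF M[of t], of 2] power_mono[OF H[of t], of 2] by simp_all
      then have "\<bar>g t\<bar> \<le> B * exp ((M\<^sup>2 + H\<^sup>2) / 2)"
        unfolding g abs_mult using B by (intro mult_mono) auto
      then show ?thesis using H[of t] by linarith
    qed
    then show ?thesis
      using bdd(2) by (intro bounded_holder_0_if_lipschitz[OF \<alpha>] lipschitz_if_derivative_bounded[OF convex_UNIV k]) auto
  qed
  have kj: "bounded_holder j \<alpha> UNIV k" if "j \<le> m" for j
    using that by (induction j) (use k0 step in auto)
  show "bounded_holder m \<alpha> UNIV g" using step[OF order_refl kj] by simp
  show "bounded_holder (Suc (Suc m)) \<alpha> UNIV h" using step[OF order_refl kj] h bdd(1)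
    by (subst bounded_holder.simps(2)) auto
qed

theorem theorem1p2:
  fixes \<alpha> :: real and f :: "real ^ 2 \<Rightarrow> real"
  assumes "0 < \<alpha>" and "\<alpha> < 1"
    and "C_holder_circle 2 \<alpha> f"
    and "\<forall>v\<in>sphere 0 1. f v > 0"
    and "\<forall>v\<in>sphere 0 1. f (- v) = f v"
    and "L1_norm_circle f < 1 / sqrt (2 * pi)"
  shows "\<exists>K. convex_body K \<and> origin_symmetric K \<and>
           C_holder_boundary 4 \<alpha> K \<and> C_holder_circle 4 \<alpha> (support_function K) \<and>
           measure gaussian_plane K < 1 / 2 \<and>
           (let h = of_angle (support_function K) in
              \<forall>\<theta>. 1 / (2 * pi) * exp (- ((deriv h \<theta>)\<^sup>2 + (h \<theta>)\<^sup>2) / 2)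
                    * (deriv (deriv h) \<theta> + h \<theta>) = of_angle f \<theta>)"
proof -
  define F where "F t = 2 * pi * of_angle f t" for t
  have F_pos: "F t > 0" for t using assms(4) by (simp add: F_def of_angle_def)
  have F_even: "F (t + pi) = F t" for t
    using assms(5) by (simp add: F_def of_angle_def circle_point_add_pi)
  have \<alpha>: "0 \<le> \<alpha>" "\<alpha> \<le> 1" using assms(1,2) by auto
  have "bounded_holder 2 \<alpha> UNIV (of_angle f)"
    using assms(3) periodic_C_holder_imp_bounded_holder[of pi "of_angle f" 2 \<alpha>] assms(5)
    by (simp add: C_holder_circle_def of_angle_def circle_point_add_pi)
  then have F_holder: "bounded_holder 2 \<alpha> UNIV F"
    unfolding F_def by (intro bounded_holder_mult bounded_holder_const convex_UNIV \<alpha>)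
  then have F_cont: "continuous_on UNIV F"
    using bounded_holder_imp_C_holder_on[OF assms(1) open_UNIV, of 0 F]
      bounded_holder_mono[OF convex_UNIV \<alpha> F_holder, of 0] by (simp add: C_holder_on_def)
  \<comment> \<open>Half of the total mass, times \<open>2 \<pi>\<close>: the hypothesis makes it
    smaller than \<open>\<pi> / sqrt (2 \<pi>) = sqrt (\<pi>/2)\<close>.\<close>
  have mass: "integral {0..pi} F < 1.28"
  proof -
    have f_cont: "continuous_on A (of_angle f)" for A
    proof -
      have "of_angle f = (\<lambda>t. F t / (2 * pi))" by (rule ext) (simp add: F_def)
      then show ?thesis using continuous_on_subset[OF F_cont, of A] by (simp add: continuous_intros)
    qed
    have "set_integrable lborel {0..2 * pi} (\<lambda>t. \<bar>of_angle f t\<bar>)"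
      by (intro borel_integrable_atLeastAtMost' continuous_intros f_cont)
    then have "L1_norm_circle f = integral {0..2 * pi} (\<lambda>t. \<bar>of_angle f t\<bar>)"
      unfolding L1_norm_circle_def by (rule set_borel_integral_eq_integral)
    also have "\<dots> = integral {0..2 * pi} (\<lambda>t. F t / (2 * pi))"
      using F_pos by (intro integral_cong) (simp add: F_def abs_of_pos zero_less_mult_iff)
    also have "\<dots> = (integral {0..pi} F + integral {pi..2 * pi} F) / (2 * pi)"
      using Henstock_Kurzweil_Integration.integral_combine[where a = 0 and c = pi and b = "2 * pi" and f = F] continuous_on_subset[OF F_cont]
      by (simp add: integrable_continuous_real)
    also have "integral {pi..2 * pi} F = integral {0..pi} F"
      using integral_periodic[OF F_cont F_even pi_gt_zero, of pi] by simp
    finally have "integral {0..pi} F = pi * L1_norm_circle f" by (simp add: field_simps)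
    also have "\<dots> < pi * (1 / sqrt (2 * pi))" using assms(6) by (intro mult_strict_left_mono) auto
    also have "\<dots> = pi / sqrt (2 * pi)" by simp
    also have "\<dots> \<le> 1.28"
    proof -
      have "pi / sqrt (2 * pi) = sqrt pi / sqrt 2"
        by (simp add: real_sqrt_mult field_simps flip: power2_eq_square)
      also have "\<dots> = sqrt (pi / 2)" by (simp add: real_sqrt_divide)
      also have "\<dots> \<le> 1.28" using pi_approx(2) by (intro real_le_lsqrt) (auto simp: power2_eq_square)
      finally show ?thesis .
    qed
    finally show ?thesis .
  qed
  obtain x where x: "\<And>t. x (t + pi) = - x t" "\<And>t. cmod (x t) < 1"
    "\<And>t. (x has_vector_derivative \<i> * cis t * of_real (F t * exp ((cmod (x t))\<^sup>2 / 2))) (at t)"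
    by (rule closed_orbit[OF F_cont F_pos F_even mass]) blast
  define h k where "h t = Re (x t * cis (- t))" and "k t = Im (x t * cis (- t))" for t
  define g where "g t = F t * exp ((cmod (x t))\<^sup>2 / 2)" for t
  have g_pos: "g t > 0" for t by (simp add: g_def F_pos)
  interpret even_support h k g
    unfolding h_def[abs_def] k_def[abs_def] using x(3) by (intro orbit_even_support x(1) g_pos) (simp add: g_def)
  have kh: "(k t)\<^sup>2 + (h t)\<^sup>2 = (cmod (x t))\<^sup>2" for t
    using cmod_power2[of "x t * cis (- t)"] by (simp add: h_def k_def norm_mult)
  have abs_hk: "\<bar>h t\<bar> \<le> cmod (x t)" "\<bar>k t\<bar> \<le> cmod (x t)" for t
    using abs_Re_le_cmod[of "x t * cis (- t)"] abs_Im_le_cmod[of "x t * cis (- t)"]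
    by (simp_all add: h_def k_def norm_mult)
  have "bounded (range h)" "bounded (range k)"
    unfolding bounded_image_real using abs_hk x(2) by (intro exI[of _ 1], force intro: order_trans less_imp_le)+
  note regular = support_regularity[OF \<alpha> F_holder h_deriv k_deriv _ this]
  have g_eq: "g t = F t * exp (((k t)\<^sup>2 + (h t)\<^sup>2) / 2)" for t by (simp add: g_def kh)
  \<comment> \<open>The maximum of \<open>h\<close> is attained, hence strictly smaller than
    \<open>1\<close>, and it is the radius of a disc around the body.\<close>
  have "measure gaussian_plane body < 1 / 2"
  proof -
    have "\<exists>s. \<forall>t\<in>{0..pi}. h t \<le> h s \<and> s \<in> {0..pi}"
      using continuous_attains_sup[of "{0..pi}" h] h_cont by force
    then obtain s where s: "\<And>t. t \<in> {0..pi} \<Longrightarrow> h t \<le> h s" by blast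
    have "h t \<le> h s" for t
    proof -
      have "h (t + of_int n * pi) = h t" for n
      proof (induction n rule: int_induct[of _ 0])
        case (step1 i)
        then show ?case using h_even[of "t + of_int i * pi"] by (simp add: algebra_simps)
      next
        case (step2 i)
        then show ?case using h_even[of "t + of_int (i - 1) * pi"] by (simp add: algebra_simps)
      qed simp
      from this[of "- \<lfloor>t / pi\<rfloor>"] show ?thesis
        using s[of "t - of_int \<lfloor>t / pi\<rfloor> * pi"] floor_divide_lower[of pi t] floor_divide_upper[of pi t]
        by (simp add: algebra_simps)
    qed
    then have "body \<subseteq> cball 0 (h s)" by (rule body_subset_cball)
    moreover have "h s < 1" using abs_hk(1)[of s] x(2)[of s] by linarith
    ultimately show ?thesis using h_pos[of s] by (intro gaussian_measure_small_ball) auto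
  qed
  moreover have "C_holder_boundary 4 \<alpha> body"
    by (rule body_boundary_holder[OF assms(1,2)]) (use regular(1) g_eq in blast)
  moreover have "C_holder_circle 4 \<alpha> (support_function body)"
    unfolding C_holder_circle_def support_function_body
    using regular(2) g_eq by (intro bounded_holder_imp_C_holder_on assms(1)) (auto simp: numeral_eq_Suc)
  moreover have "1 / (2 * pi) * exp (- ((deriv h t)\<^sup>2 + (h t)\<^sup>2) / 2) * (deriv (deriv h) t + h t) = of_angle f t" for t
  proof -
    define A where "A = (k t)\<^sup>2 + (h t)\<^sup>2"
    have "deriv h = k" using h_deriv by (intro ext DERIV_imp_deriv)
    moreover have "deriv k t = g t - h t" using k_deriv by (rule DERIV_imp_deriv)
    moreover have "g t = F t * exp (A / 2)" by (simp add: g_eq A_def)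
    ultimately have "1 / (2 * pi) * exp (- ((deriv h t)\<^sup>2 + (h t)\<^sup>2) / 2) * (deriv (deriv h) t + h t)
        = 1 / (2 * pi) * exp (- A / 2) * (F t * exp (A / 2))"
      by (simp only: A_def diff_add_cancel)
    also have "\<dots> = of_angle f t" by (simp add: F_def exp_minus)
    finally show ?thesis .
  qed
  ultimately show ?thesis
    using body_is_convex_body body_symmetric
    by (intro exI[of _ body]) (simp add: Let_def support_function_body)
qed

end
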